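(* Let $J_0=-J_0^\top\in\mathbb{R}^{n\times n}$, $J_1=J_1^\top\in\mathbb{R}^{n\times n}$, and let $Q=Q^\top\in\mathbb{R}^{n\times n}$ be positive definite. Let $\mathbb{T}$ be the time axis and let $a,b\in C^1(\mathbb{T},\mathbb{R})$ satisfy $a(t)<b(t)$ and $\dot a(t)\dot b(t)\geqslant 0$ for all $t\in\mathbb{T}$. Consider the linear first-order boundary port-Hamiltonian system on the time-varying spatial domain $[a(t),b(t)]$ with state $x(t,\cdot)\in L_2([a(t),b(t)],\mathbb{R}^n)$, defined by $$(\partial_t x,f_\partial,Qx,e_\partial)\in\mathcal{D}_{\mathcal{J}}(t),\qquad t\in\mathbb{T},$$ where $\mathcal{D}_{\mathcal{J}}(t)$ is the Stokes-Dirac structure on $[a(t),b(t)]$ associated with $\mathcal{J}=J_0+J_1\partial_s$ (defined in the context); in particular $\partial_t x=\mathcal{J}(Qx)$. Define, for $t\in\mathbb{T}$ and $\hat s\in[0,1]$, $$\hat x(t,\hat s)=\sqrt{b(t)-a(t)}\;x\big(t,\,a(t)+(b(t)-a(t))\hat s\big),\qquad \hat e(t,\hat s)=Q\hat x(t,\hat s).$$ Then the dynamics of $\hat x$ are governed by $$\partial_t\hat x(t,\hat s)=\hat{\mathcal{J}}(t)\hat e(t,\hat s)-\frac12\frac{\dot b(t)-\dot a(t)}{b(t)-a(t)}\hat x(t,\hat s)+\partial_{\hat s}\left(\frac{\dot a(t)+(\dot b(t)-\dot a(t))\hat s}{b(t)-a(t)}\hat x(t,\hat s)\right),$$ where $\hat{\mathcal{J}}(t)=J_0+\frac{1}{b(t)-a(t)}J_1\partial_{\hat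 s}$.
   Context: Dots denote time derivatives. Let $r=\operatorname{rank}J_1$. For each $t\in\mathbb{T}$, $\mathcal{D}_{\mathcal{J}}(t)$ is the set of all $(f,f_\partial,e,e_\partial)$ with $f,e\in L_2([a(t),b(t)],\mathbb{R}^n)$ and $f_\partial,e_\partial\in\mathbb{R}^r$ such that $\mathcal{J}e\in L_2([a(t),b(t)],\mathbb{R}^n)$, $f=\mathcal{J}e$, $f_\partial=S_1M\big(e(a(t))-e(b(t))\big)$ and $e_\partial=M\big(e(a(t))+e(b(t))\big)$. Here $S_1=S_1^\top\in\mathbb{R}^{r\times r}$ and the full-rank matrix $M\in\mathbb{R}^{r\times n}$ are matrices (known to exist) for which this set is a Dirac structure, i.e. equals its own orthogonal complement with respect to the symmetric bilinear form $\int_{a(t)}^{b(t)}\big((f^1)^\top e^2+(f^2)^\top e^1\big)\,\mathrm{d}s-(f^1_\partial)^\top e^2_\partial-(f^2_\partial)^\top e^1_\partial$. The variables $(f_\partial,e_\partial)$ are the boundary ports. The Hamiltonian (stored energy) is $H(x,t)=\frac12\int_{a(t)}^{b(t)}x^\top(s)Qx(s)\,\mathrm{d}s=\hat H(\hat x,t)=\frac12\int_0^1\hat x^\top(\hat s)Q\hat x(\hat s)\,\mathrm{d}\hat s$, and $\hat e=\delta_{\hat x}\hat H=Q\hat x$ is the corresponding variational derivative (co-energy variable). *)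

theory Defs
  imports "HOL-Analysis.Analysis"
begin

section \<open>Distributional derivatives on open subsets of Euclidean space\<close>

text \<open>Test functions are compactly supported and continuously differentiable. All operators
  below are of first order, and this class, unlike the smooth functions, is invariant under the
  change of variables \<open>s = a(t) + (b(t) - a(t)) z\<close>, which is only continuously differentiable
  in \<open>t\<close>. On locally integrable functions it yields the usual distributional derivative.\<close>

definition test_fun :: "'a::euclidean_space set \<Rightarrow> ('a \<Rightarrow> real) \<Rightarrow> bool" where
  "test_fun U \<phi> \<longleftrightarrow>
     (\<forall>p. \<phi> differentiable (at p)) \<and>
     (\<forall>v. continuous_on UNIV (\<lambda>p. frechet_derivative \<phi> (at p) v)) \<and>
     compact (closure {p. \<phi> p \<noteq> 0}) \<and> closure {p. \<phi> p \<noteq> 0} \<subseteq> U"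

definition loc_integrable ::
  "'a::euclidean_space set \<Rightarrow> ('a \<Rightarrow> 'b::euclidean_space) \<Rightarrow> bool" where
  "loc_integrable U f \<longleftrightarrow> (\<forall>K. compact K \<and> K \<subseteq> U \<longrightarrow> set_integrable lborel K f)"

text \<open>Action on a test function \<open>\<phi>\<close> of the distribution given by \<open>f\<close>, and of its distributional
  derivative in direction \<open>v\<close>. Scalar test functions acting on vector-valued \<open>f\<close> amount to the
  componentwise definition.\<close>

definition distr_act ::
  "'a::euclidean_space set \<Rightarrow> ('a \<Rightarrow> 'b::euclidean_space) \<Rightarrow> ('a \<Rightarrow> real) \<Rightarrow> 'b" where
  "distr_act U f \<phi> = (LINT p:U|lborel. \<phi> p *\<^sub>R f p)"

definition distr_deriv ::
  "'a::euclidean_space set \<Rightarrow> 'a \<Rightarrow> ('a \<Rightarrow> 'b::euclidean_space) \<Rightarrow> ('a \<Rightarrow> real) \<Rightarrow> 'b" where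
  "distr_deriv U v f \<phi> = - (LINT p:U|lborel. frechet_derivative \<phi> (at p) v *\<^sub>R f p)"

definition has_weak_deriv ::
  "'a::euclidean_space set \<Rightarrow> 'a \<Rightarrow> ('a \<Rightarrow> 'b::euclidean_space) \<Rightarrow> ('a \<Rightarrow> 'b) \<Rightarrow> bool" where
  "has_weak_deriv U v f g \<longleftrightarrow> loc_integrable U f \<and> loc_integrable U g \<and>
     (\<forall>\<phi>. test_fun U \<phi> \<longrightarrow> distr_deriv U v f \<phi> = distr_act U g \<phi>)"

definition C1_fun_on ::
  "'a::euclidean_space set \<Rightarrow> ('a \<Rightarrow> 'b::euclidean_space) \<Rightarrow> bool" where
  "C1_fun_on D f \<longleftrightarrow> (\<exists>f'. (\<forall>p\<in>D. (f has_derivative f' p) (at p within D)) \<and>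
     (\<forall>v. continuous_on D (\<lambda>p. f' p v)))"


section \<open>The Stokes-Dirac structure on an interval\<close>

definition L2_on :: "real set \<Rightarrow> (real \<Rightarrow> 'b::euclidean_space) \<Rightarrow> bool" where
  "L2_on I f \<longleftrightarrow> set_borel_measurable lborel I f \<and>
     set_integrable lborel I (\<lambda>s. (norm (f s))\<^sup>2)"

text \<open>\<open>f = J\<^sub>0 e + J\<^sub>1 \<partial>\<^sub>s e\<close> on the interval from \<open>l\<close> to \<open>u\<close>. As \<open>J\<^sub>1\<close> may be singular, only the
  distribution \<open>J\<^sub>1 \<partial>\<^sub>s e = \<partial>\<^sub>s (J\<^sub>1 e)\<close> is required to be a function, not \<open>\<partial>\<^sub>s e\<close> itself.\<close>

definition J_applied ::
  "real \<Rightarrow> real \<Rightarrow> real^'n^'n \<Rightarrow> real^'n^'n \<Rightarrow> (real \<Rightarrow> real^'n) \<Rightarrow> (real \<Rightarrow> real^'n) \<Rightarrow> bool" where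
  "J_applied l u J0 J1 e f \<longleftrightarrow>
     has_weak_deriv {l<..<u} 1 (\<lambda>s. J1 *v e s) (\<lambda>s. f s - J0 *v e s)"

text \<open>Since \<open>r = rank J\<^sub>1\<close> is a number and may be zero, vectors in \<open>\<real>\<^sup>r\<close> are functions on \<open>nat\<close>
  vanishing outside \<open>{..<r}\<close>, an \<open>r \<times> r\<close> matrix has entries \<open>S i j\<close> with \<open>i, j < r\<close>, and an
  \<open>r \<times> n\<close> matrix is the family of its rows \<open>M i\<close> with \<open>i < r\<close>.\<close>

definition Rvec :: "nat \<Rightarrow> (nat \<Rightarrow> real) set" where
  "Rvec r = {v. \<forall>i\<ge>r. v i = 0}"

type_synonym 'n bond =
  "(real \<Rightarrow> real^'n) \<times> (nat \<Rightarrow> real) \<times> (real \<Rightarrow> real^'n) \<times> (nat \<Rightarrow> real)"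

definition bond_space :: "real \<Rightarrow> real \<Rightarrow> nat \<Rightarrow> ('n::finite) bond set" where
  "bond_space l u r =
     {(f, fb, e, eb). L2_on {l..u} f \<and> fb \<in> Rvec r \<and> L2_on {l..u} e \<and> eb \<in> Rvec r}"

definition bond_form :: "real \<Rightarrow> real \<Rightarrow> nat \<Rightarrow> ('n::finite) bond \<Rightarrow> 'n bond \<Rightarrow> real" where
  "bond_form l u r = (\<lambda>(f1, fb1, e1, eb1) (f2, fb2, e2, eb2).
     (LINT s:{l..u}|lborel. f1 s \<bullet> e2 s + f2 s \<bullet> e1 s)
     - (\<Sum>i<r. fb1 i * eb2 i) - (\<Sum>i<r. fb2 i * eb1 i))"

definition orth_complement ::
  "real \<Rightarrow> real \<Rightarrow> nat \<Rightarrow> ('n::finite) bond set \<Rightarrow> 'n bond set" where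
  "orth_complement l u r D = {p \<in> bond_space l u r. \<forall>q\<in>D. bond_form l u r p q = 0}"

definition dirac_structure :: "real \<Rightarrow> real \<Rightarrow> nat \<Rightarrow> ('n::finite) bond set \<Rightarrow> bool" where
  "dirac_structure l u r D \<longleftrightarrow> D = orth_complement l u r D"

text \<open>The end point values of \<open>M e\<close> are those of its continuous representative \<open>w\<close>: \<open>e\<close> is only
  given up to null sets, and only \<open>J\<^sub>1 e\<close>, hence \<open>M e\<close>, has a trace.\<close>

definition stokes_dirac ::
  "real \<Rightarrow> real \<Rightarrow> real^'n^'n \<Rightarrow> real^'n^'n \<Rightarrow> (nat \<Rightarrow> nat \<Rightarrow> real) \<Rightarrow> (nat \<Rightarrow> real^'n)
    \<Rightarrow> ('n::finite) bond set" where
  "stokes_dirac l u J0 J1 S1 M =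
     {(f, fb, e, eb). (f, fb, e, eb) \<in> bond_space l u (rank J1) \<and>
        J_applied l u J0 J1 e f \<and>
        (\<exists>w. (\<forall>i<rank J1. continuous_on {l..u} (w i) \<and>
                 (AE s in lborel. s \<in> {l..u} \<longrightarrow> w i s = M i \<bullet> e s)) \<and>
             (\<forall>i<rank J1. fb i = (\<Sum>j<rank J1. S1 i j * (w j l - w j u))) \<and>
             (\<forall>i<rank J1. eb i = w i l + w i u))}"

end

theory Submission
  imports Defs
begin

text \<open>Write \<open>l = b - a\<close>. The map
  \<open>(t, z) \<mapsto> (t, a(t) + l(t) z)\<close> straightens the moving domain and has Jacobian \<open>l\<close>. Testing
  \<open>\<partial>\<^sub>t x\<close> on the moving domain with \<open>\<psi>(t, (s - a(t)) / l(t)) / sqrt (l(t))\<close> and substituting gives the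
  weak equation: the derivative of the weight produces the term \<open>- l' / (2 l)\<close>, that of the second
  argument the transport term. For a classical solution the equation \<open>\<partial>\<^sub>t x = J\<^sub>0 Q x + J\<^sub>1 Q \<partial>\<^sub>s x\<close>
  follows on the open domain by testing, extends to its boundary by density, and the claim is then
  the chain rule.\<close>

section \<open>Test functions and local integrability\<close>

text \<open>Two kinds of hypothesis have to be joined: the time derivative is given on the
  space-time domain, whereas the operator in \<open>s\<close> is given separately at each time, and
  only through \<open>J1 *v e\<close>. They are transformed separately, by a shear of the plane and
  by an affine map of each interval, both instances of one substitution locale; in the
  distributional conclusion they meet in the function \<open>Jeh\<close>, the rescaled
  \<open>xt\<close>. The weight 1 / sqrt (l) is forced: multiplied by the Jacobian it gives the
  factor sqrt (l) of \<open>xh\<close>. Since \<open>x\<close> need not have an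
  \<open>s\<close>-derivative, the transport term remains a distributional derivative. At end points
  of \<open>T\<close> the derivatives of \<open>a\<close> and \<open>b\<close> are one-sided, so
  distributions live over \<open>interior T\<close>; the classical part works with derivatives
  relative to the domain with its boundary included.\<close>

lemma has_derivative_0_outside_closed:
  assumes "closed K" "\<And>p. p \<notin> K \<Longrightarrow> f p = 0" "p \<notin> K"
  shows "(f has_derivative (\<lambda>_. 0)) (at p)"
proof (rule has_derivative_transform_within_open[OF has_derivative_const[of 0]])
  show "open (- K)" "p \<in> - K" using assms by auto
  show "0 = f q" if "q \<in> - K" for q using assms(2)[of q] that by simp
qed

lemma test_fun_eq_0:
  assumes "p \<notin> closure {p. \<phi> p \<noteq> 0}"
  shows "\<phi> p = (0::real)" "frechet_derivative \<phi> (at p) v = 0"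
proof -
  have 0: "\<phi> q = 0" if "q \<notin> closure {p. \<phi> p \<noteq> 0}" for q
    using that subsetD[OF closure_subset, of q "{p. \<phi> p \<noteq> 0}"] by blast
  show "\<phi> p = 0" using assms by (rule 0)
  have "(\<phi> has_derivative (\<lambda>_. 0)) (at p)"
    using closed_closure 0 assms by (rule has_derivative_0_outside_closed)
  from frechet_derivative_at[OF this] show "frechet_derivative \<phi> (at p) v = 0"
    by metis
qed

lemma test_fun_has_derivative:
  assumes "test_fun U \<phi>"
  shows "(\<phi> has_derivative frechet_derivative \<phi> (at p)) (at p)"
  using assms by (simp add: test_fun_def frechet_derivative_works)

lemma test_fun_continuous_on:
  assumes "test_fun U \<phi>"
  shows "continuous_on S \<phi>" "continuous_on S (\<lambda>p. frechet_derivative \<phi> (at p) v)"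
proof -
  show "continuous_on S \<phi>"
    using assms by (auto simp: test_fun_def intro!: continuous_at_imp_continuous_on
        differentiable_imp_continuous_within)
  show "continuous_on S (\<lambda>p. frechet_derivative \<phi> (at p) v)"
    using assms by (auto simp: test_fun_def intro: continuous_on_subset)
qed

text \<open>The open sets \<open>U\<close> and \<open>- K\<close> cover the space, and the function
  vanishes locally off \<open>K\<close>. Hence a derivative given only on \<open>U\<close> yields
  continuous differentiability everywhere, and \<open>K\<close> may be any compact set containing
  the support.\<close>

lemma test_funI:
  assumes "open U" "compact K" "K \<subseteq> U" and 0: "\<And>p. p \<notin> K \<Longrightarrow> \<phi> p = 0"
    and d: "\<And>p. p \<in> U \<Longrightarrow> (\<phi> has_derivative \<phi>' p) (at p)"
    and c: "\<And>v. continuous_on U (\<lambda>p. \<phi>' p v)"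
  shows "test_fun U \<phi>"
proof -
  have cl: "closed K" using assms(2) by (rule compact_imp_closed)
  have d0: "(\<phi> has_derivative (\<lambda>_. 0)) (at p)" if "p \<notin> K" for p
    using cl 0 that by (rule has_derivative_0_outside_closed)
  have eq: "frechet_derivative \<phi> (at p) = \<phi>' p" if "p \<in> U" for p
    using d[OF that] by (rule frechet_derivative_at[symmetric])
  have eq0: "frechet_derivative \<phi> (at p) = (\<lambda>_. 0)" if "p \<in> - K" for p
    using frechet_derivative_at[OF d0[of p]] that by simp
  have "\<phi> differentiable (at p)" for p
    using d d0 \<open>K \<subseteq> U\<close> unfolding differentiable_def by blast
  moreover have "continuous_on (U \<union> - K) (\<lambda>p. frechet_derivative \<phi> (at p) v)" for v
  proof (rule continuous_on_open_Un)
    show "continuous_on U (\<lambda>p. frechet_derivative \<phi> (at p) v)"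
      using c[of v] by (rule continuous_on_eq) (simp add: eq)
    show "continuous_on (- K) (\<lambda>p. frechet_derivative \<phi> (at p) v)"
      by (rule continuous_on_eq[OF continuous_on_const[of _ 0]]) (simp add: eq0)
  qed (use \<open>open U\<close> cl in auto)
  moreover have "U \<union> - K = UNIV" using \<open>K \<subseteq> U\<close> by auto
  moreover have "closure {p. \<phi> p \<noteq> 0} \<subseteq> K"
    by (rule closure_minimal[OF _ cl]) (use 0 in auto)
  moreover from this have "compact (closure {p. \<phi> p \<noteq> 0})"
    using compact_Int_closed[OF assms(2) closed_closure] by (metis inf.absorb2)
  ultimately show ?thesis
    using \<open>K \<subseteq> U\<close> unfolding test_fun_def by (metis subset_trans)
qed

lemma test_fun_compact_support:
  assumes "test_fun U \<phi>"
  obtains K where "compact K" "K \<subseteq> U" "\<And>p. p \<notin> K \<Longrightarrow> \<phi> p = 0"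
    "\<And>p v. p \<notin> K \<Longrightarrow> frechet_derivative \<phi> (at p) v = 0"
proof
  show "compact (closure {p. \<phi> p \<noteq> 0})" "closure {p. \<phi> p \<noteq> 0} \<subseteq> U"
    using assms by (auto simp: test_fun_def)
qed (rule test_fun_eq_0, assumption)+

lemma set_integrable_scaleR_continuous:
  fixes f :: "'a::euclidean_space \<Rightarrow> 'b::euclidean_space" and h :: "'a \<Rightarrow> real"
  assumes "compact K" "continuous_on K h" "set_integrable lborel K f"
  shows "set_integrable lborel K (\<lambda>p. h p *\<^sub>R f p)"
proof -
  have "bounded (h ` K)"
    using assms by (intro compact_imp_bounded compact_continuous_image)
  then obtain B where B: "\<And>p. p \<in> K \<Longrightarrow> norm (h p) \<le> B"
    by (auto simp: bounded_iff)
  have m: "(\<lambda>p. indicator K p *\<^sub>R h p) \<in> borel_measurable borel"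
    using assms by (intro borel_measurable_continuous_on_indicator) (auto simp: borel_compact)
  have f: "integrable lborel (\<lambda>p. indicator K p *\<^sub>R f p)"
    using assms by (simp add: set_integrable_def)
  \<comment> \<open>The indicator is doubled because each factor is known to be measurable only
    after being cut off to \<open>K\<close>.\<close>
  have eq: "(\<lambda>p. indicator K p *\<^sub>R h p *\<^sub>R f p)
      = (\<lambda>p. (indicator K p *\<^sub>R h p) *\<^sub>R (indicator K p *\<^sub>R f p))"
    by (auto simp: indicator_def)
  have "integrable lborel (\<lambda>p. (indicator K p *\<^sub>R h p) *\<^sub>R (indicator K p *\<^sub>R f p))"
  proof (rule Bochner_Integration.integrable_bound)
    show "integrable lborel (\<lambda>p. B *\<^sub>R (indicator K p *\<^sub>R f p))"
      using f by (rule integrable_scaleR_right)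
    show "(\<lambda>p. (indicator K p *\<^sub>R h p) *\<^sub>R (indicator K p *\<^sub>R f p)) \<in> borel_measurable lborel"
      using m f[THEN borel_measurable_integrable] unfolding measurable_lborel2
      by (rule borel_measurable_scaleR)
    show "AE p in lborel. norm ((indicator K p *\<^sub>R h p) *\<^sub>R (indicator K p *\<^sub>R f p))
        \<le> norm (B *\<^sub>R (indicator K p *\<^sub>R f p))"
      using B by (intro AE_I2) (force simp: indicator_def intro!: mult_right_mono)
  qed
  then show ?thesis unfolding set_integrable_def eq .
qed

lemma loc_integrable_scaleR_continuous:
  assumes "continuous_on U h" "loc_integrable U f"
  shows "loc_integrable U (\<lambda>p. h p *\<^sub>R f p)"
  using assms unfolding loc_integrable_def
  by (auto intro!: set_integrable_scaleR_continuous intro: continuous_on_subset)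

lemma loc_integrable_continuous:
  assumes "continuous_on U f"
  shows "loc_integrable U f"
  unfolding loc_integrable_def set_integrable_def
  by (auto intro!: borel_integrable_compact continuous_on_subset[OF assms])

text \<open>Local integrability gives no bound near the boundary of \<open>U\<close> or at infinity;
  the factor \<open>h\<close> confines the integrand to \<open>K\<close>, where \<open>h\<close> is
  bounded.\<close>

lemma set_integrable_cutoff:
  fixes f :: "'a::euclidean_space \<Rightarrow> 'b::euclidean_space" and h :: "'a \<Rightarrow> real"
  assumes "loc_integrable U f" "compact K" "K \<subseteq> U" "continuous_on U h"
    and 0: "\<And>p. p \<notin> K \<Longrightarrow> h p = 0"
  shows "set_integrable lborel U (\<lambda>p. h p *\<^sub>R f p)"
proof -
  have "set_integrable lborel K (\<lambda>p. h p *\<^sub>R f p)"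
    using assms by (intro set_integrable_scaleR_continuous)
      (auto simp: loc_integrable_def intro: continuous_on_subset)
  moreover have "(\<lambda>p. indicator K p *\<^sub>R h p *\<^sub>R f p) = (\<lambda>p. indicator U p *\<^sub>R h p *\<^sub>R f p)"
    using 0 \<open>K \<subseteq> U\<close> by (force simp: indicator_def fun_eq_iff)
  ultimately show ?thesis by (simp add: set_integrable_def)
qed

lemma set_integrable_test_fun:
  assumes "test_fun U \<phi>" "loc_integrable U f"
  shows "set_integrable lborel U (\<lambda>p. \<phi> p *\<^sub>R f p)"
    "set_integrable lborel U (\<lambda>p. frechet_derivative \<phi> (at p) v *\<^sub>R f p)"
proof -
  obtain K where "compact K" "K \<subseteq> U" "\<And>p. p \<notin> K \<Longrightarrow> \<phi> p = 0"
    "\<And>p v. p \<notin> K \<Longrightarrow> frechet_derivative \<phi> (at p) v = 0"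
    using test_fun_compact_support[OF assms(1)] by blast
  then show "set_integrable lborel U (\<lambda>p. \<phi> p *\<^sub>R f p)"
    "set_integrable lborel U (\<lambda>p. frechet_derivative \<phi> (at p) v *\<^sub>R f p)"
    using assms by (auto intro!: set_integrable_cutoff test_fun_continuous_on)
qed

text \<open>Lebesgue measure is translation invariant, so every difference quotient of
  \<open>F\<close> in direction \<open>v\<close> integrates to zero, and dominated convergence
  carries this over to the derivative. No choice of coordinates is involved.\<close>

lemma integral_directional_derivative_eq_0:
  fixes F :: "'a::euclidean_space \<Rightarrow> 'b::euclidean_space"
  assumes d: "\<And>p. (F has_derivative F' p) (at p)"
    and c: "continuous_on UNIV (\<lambda>p. F' p v)"
    and K: "compact K" "\<And>p. p \<notin> K \<Longrightarrow> F p = 0"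
  shows "(LINT p|lborel. F' p v) = 0"
proof -
  have cF: "continuous_on UNIV F"
    using d by (auto intro!: has_derivative_continuous continuous_at_imp_continuous_on)
  have F'0: "F' p v = 0" if "p \<notin> K" for p
  proof -
    have "(F has_derivative (\<lambda>_. 0)) (at p)"
      using compact_imp_closed[OF K(1)] K(2) that by (rule has_derivative_0_outside_closed)
    from has_derivative_unique[OF this d[of p]] show ?thesis by metis
  qed
  have "bounded ((\<lambda>p. F' p v) ` K)"
    using K c by (intro compact_imp_bounded compact_continuous_image) (auto intro: continuous_on_subset)
  then obtain B0 where B0: "\<And>p. p \<in> K \<Longrightarrow> norm (F' p v) \<le> B0"
    by (auto simp: bounded_iff)
  \<comment> \<open>If \<open>K\<close> is empty, \<open>B0\<close> may be negative; the maximum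
    makes the bound valid off \<open>K\<close> as well.\<close>
  define B where "B = max B0 0"
  have B: "norm (F' p v) \<le> B" for p
    using B0[of p] F'0[of p] by (cases "p \<in> K") (auto simp: B_def)
  have B_nn: "B \<ge> 0" by (simp add: B_def)
  obtain R where R: "\<And>p. p \<in> K \<Longrightarrow> norm p \<le> R"
    using compact_imp_bounded[OF K(1)] by (auto simp: bounded_iff)
  \<comment> \<open>Step sizes of at most 1 keep the supports of all difference quotients within
    distance \<open>norm v\<close> of \<open>K\<close>, whence the fixed ball of radius
    \<open>R + norm v\<close> below.\<close>
  define e where "e = (\<lambda>n. 1 / real (Suc n))"
  have e: "e n > 0" "e n \<le> 1" for n by (auto simp: e_def)
  have e0: "e \<longlonglongrightarrow> 0" unfolding e_def by (rule LIMSEQ_Suc[OF lim_1_over_n])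
  define D where "D = (\<lambda>n p. (1 / e n) *\<^sub>R (F (e n *\<^sub>R v + p) - F p))"
  have line: "((\<lambda>t. F (t *\<^sub>R v + p)) has_derivative (\<lambda>h. F' (t *\<^sub>R v + p) (h *\<^sub>R v))) (at t within S)" for t p S
    by (rule has_derivative_compose[OF _ d, of _ "\<lambda>h. h *\<^sub>R v"]) (auto intro!: derivative_eq_intros)
  have lin: "F' q (h *\<^sub>R v) = h *\<^sub>R F' q v" for q h
    using has_derivative_linear[OF d] by (simp add: linear_cmul)
  have intF: "integrable lborel F"
  proof -
    have "integrable lborel (\<lambda>p. indicator K p *\<^sub>R F p)"
      by (rule borel_integrable_compact[OF K(1) continuous_on_subset[OF cF]]) simp
    moreover have "(\<lambda>p. indicator K p *\<^sub>R F p) = F"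
      using K(2) by (force simp: indicator_def)
    ultimately show ?thesis by simp
  qed
  have shift: "integrable lborel (\<lambda>p. F (q + p)) \<and> (LINT p|lborel. F (q + p)) = (LINT p|lborel. F p)" for q
  proof -
    have m: "F \<in> borel_measurable borel" using cF by (rule borel_measurable_continuous_onI)
    have "integrable (distr lborel borel ((+) q)) F" "(LINT p|distr lborel borel ((+) q). F p) = (LINT p|lborel. F p)"
      using intF lborel_distr_plus[of q] by simp_all
    then show ?thesis using m by (simp add: integrable_distr_eq integral_distr)
  qed
  have D_int: "(LINT p|lborel. D n p) = 0" for n
    using shift intF by (simp add: D_def)
  have "(\<lambda>n. LINT p|lborel. D n p) \<longlonglongrightarrow> (LINT p|lborel. F' p v)"
  proof (rule integral_dominated_convergence)
    show "integrable lborel (\<lambda>p. indicator (cball (0::'a) (R + norm v)) p *\<^sub>R B)"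
      by (rule borel_integrable_compact) auto
    show "(\<lambda>p. F' p v) \<in> borel_measurable lborel"
      using c by (simp add: borel_measurable_continuous_onI)
    show "D n \<in> borel_measurable lborel" for n
      unfolding D_def
      by (auto intro!: borel_measurable_continuous_onI continuous_intros continuous_on_compose2[OF cF])
    show "AE p in lborel. (\<lambda>n. D n p) \<longlonglongrightarrow> F' p v"
    proof (rule AE_I2)
      fix p
      have "((\<lambda>h. ((F (h *\<^sub>R v + p) - F p) - h *\<^sub>R F' p v) /\<^sub>R norm h) \<longlongrightarrow> 0) (at 0)"
        using line[of p 0 UNIV] by (simp add: has_derivative_at_within lin)
      then have "((\<lambda>h. norm ((1 / h) *\<^sub>R (F (h *\<^sub>R v + p) - F p) - F' p v)) \<longlongrightarrow> 0) (at 0)"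
        unfolding tendsto_norm_zero_iff[of "\<lambda>h. (_ h) /\<^sub>R norm h", symmetric]
      proof (rule Lim_transform_eventually)
        show "\<forall>\<^sub>F h in at 0. norm (((F (h *\<^sub>R v + p) - F p) - h *\<^sub>R F' p v) /\<^sub>R norm h)
            = norm ((1 / h) *\<^sub>R (F (h *\<^sub>R v + p) - F p) - F' p v)"
        proof (rule eventually_mono[OF eventually_neq_at_within[of 0]])
          fix h :: real
          assume "h \<noteq> 0"
          then have "(1 / h) *\<^sub>R (F (h *\<^sub>R v + p) - F p) - F' p v
              = (1 / h) *\<^sub>R ((F (h *\<^sub>R v + p) - F p) - h *\<^sub>R F' p v)"
            by (simp add: scaleR_diff_right)
          then show "norm (((F (h *\<^sub>R v + p) - F p) - h *\<^sub>R F' p v) /\<^sub>R norm h)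
            = norm ((1 / h) *\<^sub>R (F (h *\<^sub>R v + p) - F p) - F' p v)"
            by (simp add: divide_inverse)
        qed
      qed
      then have "((\<lambda>h. (1 / h) *\<^sub>R (F (h *\<^sub>R v + p) - F p)) \<longlongrightarrow> F' p v) (at 0)"
        by (simp add: tendsto_norm_zero_iff LIM_zero_cancel)
      moreover have "filterlim e (at 0) sequentially"
        using e0 e by (auto simp: filterlim_at intro!: always_eventually less_imp_neq[symmetric])
      ultimately show "(\<lambda>n. D n p) \<longlonglongrightarrow> F' p v"
        unfolding D_def by (rule filterlim_compose)
    qed
    show "AE p in lborel. norm (D n p) \<le> indicator (cball 0 (R + norm v)) p *\<^sub>R B" for n
    proof (rule AE_I2)
      fix p
      show "norm (D n p) \<le> indicator (cball 0 (R + norm v)) p *\<^sub>R B"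
      proof (cases "norm p \<le> R + norm v")
        case True
        \<comment> \<open>Mean value inequality on the line through \<open>p\<close> in direction
          \<open>v\<close>, along which the derivative has norm at most \<open>B\<close>.\<close>
        have "norm (F (e n *\<^sub>R v + p) - F (0 *\<^sub>R v + p)) \<le> B * norm (e n - 0)"
        proof (rule differentiable_bound[of UNIV])
          show "onorm (\<lambda>h. F' (t *\<^sub>R v + p) (h *\<^sub>R v)) \<le> B" for t
            using B[of "t *\<^sub>R v + p"] B_nn
            by (intro onorm_bound) (auto simp: lin mult.commute[of B] intro!: mult_left_mono)
        qed (use line in auto)
        then show ?thesis using e[of n] True
          by (simp add: D_def divide_simps mult.commute)
      next
        case False
        have "p \<notin> K" using R[of p] False norm_ge_zero[of v] by linarith
        moreover have "e n *\<^sub>R v + p \<notin> K"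
        proof
          assume "e n *\<^sub>R v + p \<in> K"
          then have "norm (e n *\<^sub>R v + p) \<le> R" by (rule R)
          moreover have "norm (e n *\<^sub>R v) \<le> norm v"
            using e[of n] by (simp add: mult_left_le_one_le)
          ultimately show False using False norm_triangle_ineq4[of "e n *\<^sub>R v + p" "e n *\<^sub>R v"] by simp
        qed
        ultimately show ?thesis using False K(2) by (simp add: D_def)
      qed
    qed
  qed
  then show ?thesis using D_int by (simp add: LIMSEQ_const_iff)
qed

section \<open>Weak derivatives of continuously differentiable functions\<close>

text \<open>Integration by parts without boundary term: the product of the test function and
  \<open>f\<close> has compact support in \<open>U\<close>, so its directional derivative integrates
  to zero, and the product rule splits that integral into the two sides.\<close>

lemma C1_has_weak_deriv:
  fixes f :: "'a::euclidean_space \<Rightarrow> 'b::euclidean_space"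
  assumes U: "open U" and d: "\<And>p. p \<in> U \<Longrightarrow> (f has_derivative f' p) (at p)"
    and c: "continuous_on U (\<lambda>p. f' p v)"
  shows "has_weak_deriv U v f (\<lambda>p. f' p v)"
proof -
  have cf: "continuous_on U f"
    using d by (auto intro!: has_derivative_continuous continuous_at_imp_continuous_on)
  have f_loc: "loc_integrable U f" "loc_integrable U (\<lambda>p. f' p v)"
    by (rule loc_integrable_continuous, fact)+
  have "distr_deriv U v f \<phi> = distr_act U (\<lambda>p. f' p v) \<phi>" if \<phi>: "test_fun U \<phi>" for \<phi>
  proof -
    obtain K where K: "compact K" "K \<subseteq> U" and \<phi>0: "\<And>p. p \<notin> K \<Longrightarrow> \<phi> p = 0"
      and \<phi>'0: "\<And>p v. p \<notin> K \<Longrightarrow> frechet_derivative \<phi> (at p) v = 0"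
      using test_fun_compact_support[OF \<phi>] by blast
    \<comment> \<open>Nothing is known about \<open>f'\<close> off \<open>U\<close>; the product
      vanishes there, and its derivative is set to 0 by hand.\<close>
    define F' where "F' = (\<lambda>p h. if p \<in> U
      then \<phi> p *\<^sub>R f' p h + frechet_derivative \<phi> (at p) h *\<^sub>R f p else 0)"
    have "(LINT p|lborel. F' p v) = 0"
    proof (rule integral_directional_derivative_eq_0)
      show "compact K" by fact
      show 0: "\<phi> p *\<^sub>R f p = 0" if "p \<notin> K" for p using \<phi>0[OF that] by simp
      show "((\<lambda>p. \<phi> p *\<^sub>R f p) has_derivative F' p) (at p)" for p
      proof (cases "p \<in> U")
        case True
        then show ?thesis
          using has_derivative_scaleR[OF test_fun_has_derivative[OF \<phi>] d[OF True]]
          by (simp add: F'_def)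
      next
        case False
        then have "p \<notin> K" using K by blast
        from has_derivative_0_outside_closed[of _ "\<lambda>p. \<phi> p *\<^sub>R f p", OF compact_imp_closed[OF K(1)] 0 this]
        show ?thesis using False by (simp add: F'_def)
      qed
      have "continuous_on (U \<union> - K) (\<lambda>p. F' p v)"
      proof (rule continuous_on_open_Un)
        have "continuous_on U (\<lambda>p. \<phi> p *\<^sub>R f' p v + frechet_derivative \<phi> (at p) v *\<^sub>R f p)"
          using cf c by (intro continuous_intros test_fun_continuous_on[OF \<phi>])
        then show "continuous_on U (\<lambda>p. F' p v)"
          by (rule continuous_on_eq) (simp add: F'_def)
        show "continuous_on (- K) (\<lambda>p. F' p v)"
          by (rule continuous_on_eq[OF continuous_on_const[of _ 0]]) (simp add: F'_def \<phi>0 \<phi>'0)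
        show "open (- K)" using compact_imp_closed[OF K(1)] by (rule open_Compl)
      qed (rule U)
      moreover have "U \<union> - K = UNIV" using K(2) by blast
      ultimately show "continuous_on UNIV (\<lambda>p. F' p v)" by simp
    qed
    moreover have "F' p v = indicator U p *\<^sub>R \<phi> p *\<^sub>R f' p v
        + indicator U p *\<^sub>R frechet_derivative \<phi> (at p) v *\<^sub>R f p" for p
      by (simp add: F'_def)
    moreover note set_integrable_test_fun(1)[OF \<phi> f_loc(2)] set_integrable_test_fun(2)[OF \<phi> f_loc(1), of v]
    ultimately show ?thesis
      by (simp add: distr_deriv_def distr_act_def set_lebesgue_integral_def set_integrable_def
          eq_neg_iff_add_eq_0 neg_eq_iff_add_eq_0 add.commute)
  qed
  then show ?thesis using f_loc by (simp add: has_weak_deriv_def)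
qed

section \<open>The fundamental lemma of the calculus of variations\<close>

lemma has_real_derivative_max_0_square:
  "((\<lambda>y::real. (max 0 y)\<^sup>2) has_real_derivative 2 * max 0 y) (at y)"
proof (cases y "0::real" rule: linorder_cases)
  case less
  then have "((\<lambda>_. 0) has_real_derivative 2 * max 0 y) (at y)" by (simp add: max_def)
  then show ?thesis
    by (rule has_field_derivative_transform_within_open[of _ _ _ "{..<0}"]) (use less in auto)
next
  case greater
  then have "((\<lambda>y. y\<^sup>2) has_real_derivative 2 * max 0 y) (at y)"
    by (auto intro!: derivative_eq_intros)
  then show ?thesis
    by (rule has_field_derivative_transform_within_open[of _ _ _ "{0<..}"]) (use greater in auto)
next
  case equal
  have "((\<lambda>h::real. (max 0 h)\<^sup>2 / h) \<longlongrightarrow> 0) (at 0)"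
  proof (rule Lim_null_comparison)
    show "\<forall>\<^sub>F h::real in at 0. norm ((max 0 h)\<^sup>2 / h) \<le> \<bar>h\<bar>"
      by (intro always_eventually) (auto simp: max_def power2_eq_square)
    show "((\<lambda>h::real. \<bar>h\<bar>) \<longlongrightarrow> 0) (at 0)"
      by (rule tendsto_eq_intros) auto
  qed
  then show ?thesis using equal by (simp add: has_field_derivative_iff)
qed

text \<open>Squaring the positive part removes its kink on the sphere of radius \<open>r\<close>, so
  this truncated polynomial is continuously differentiable and serves as a bump function.\<close>

lemma test_fun_bump:
  fixes p :: "'a::euclidean_space"
  assumes "cball p r \<subseteq> U" "open U" "r \<ge> 0"
  shows "test_fun U (\<lambda>q. (max 0 (r\<^sup>2 - (q - p) \<bullet> (q - p)))\<^sup>2)"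
proof (rule test_funI[OF assms(2) compact_cball assms(1)])
  fix q
  assume "q \<notin> cball p r"
  then have "r < norm (q - p)" by (simp add: dist_norm norm_minus_commute)
  then have "r\<^sup>2 \<le> (norm (q - p))\<^sup>2" using \<open>r \<ge> 0\<close> by (intro power_mono) auto
  then show "(max 0 (r\<^sup>2 - (q - p) \<bullet> (q - p)))\<^sup>2 = 0"
    by (simp add: power2_norm_eq_inner max_def)
next
  fix q
  have "((\<lambda>q. r\<^sup>2 - (q - p) \<bullet> (q - p)) has_derivative (\<lambda>h. - 2 * ((q - p) \<bullet> h))) (at q)"
    by (auto intro!: derivative_eq_intros simp: inner_commute)
  from has_derivative_compose[OF this
      has_real_derivative_max_0_square[unfolded has_field_derivative_def]]
  show "((\<lambda>q. (max 0 (r\<^sup>2 - (q - p) \<bullet> (q - p)))\<^sup>2) has_derivative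
      (\<lambda>h. 2 * max 0 (r\<^sup>2 - (q - p) \<bullet> (q - p)) * (- 2 * ((q - p) \<bullet> h)))) (at q)" .
next
  show "continuous_on U (\<lambda>q. 2 * max 0 (r\<^sup>2 - (q - p) \<bullet> (q - p)) * (- 2 * ((q - p) \<bullet> v)))" for v
    by (intro continuous_intros)
qed

text \<open>If \<open>h p\<close> were nonzero, a bump concentrated where \<open>h\<close> has
  positive inner product with \<open>h p\<close> would have an action with positive inner product
  with \<open>h p\<close>. Pairing with this one vector reduces the vector-valued case to a scalar
  one.\<close>

lemma distr_act_eq_0_imp_eq_0:
  fixes h :: "'a::euclidean_space \<Rightarrow> 'b::euclidean_space"
  assumes U: "open U" and h: "continuous_on U h"
    and 0: "\<And>\<phi>. test_fun U \<phi> \<Longrightarrow> distr_act U h \<phi> = 0" and p: "p \<in> U"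
  shows "h p = 0"
proof (rule ccontr)
  assume "h p \<noteq> 0"
  define W where "W = U \<inter> (\<lambda>q. h q \<bullet> h p) -` {0<..}"
  have "open W"
    unfolding W_def by (intro continuous_open_preimage continuous_intros h U)
  moreover have "p \<in> W" using p \<open>h p \<noteq> 0\<close> by (simp add: W_def)
  ultimately obtain r where r: "r > 0" "cball p r \<subseteq> W"
    unfolding open_contains_cball by blast
  define \<phi> where "\<phi> = (\<lambda>q. (max 0 (r\<^sup>2 - (q - p) \<bullet> (q - p)))\<^sup>2)"
  have \<phi>: "test_fun U \<phi>" unfolding \<phi>_def using r U by (intro test_fun_bump) (auto simp: W_def)
  have \<phi>_0: "\<phi> q = 0" if "q \<notin> ball p r" for q
  proof -
    have "r \<le> norm (q - p)" using that by (simp add: dist_norm norm_minus_commute)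
    then have "r\<^sup>2 \<le> (norm (q - p))\<^sup>2" using r by (intro power_mono) auto
    then show ?thesis by (simp add: \<phi>_def power2_norm_eq_inner max_def)
  qed
  have \<phi>_pos: "\<phi> q > 0" if "q \<in> ball p r" for q
  proof -
    have "norm (q - p) < r" using that by (simp add: dist_norm norm_minus_commute)
    then have "(norm (q - p))\<^sup>2 < r\<^sup>2" using r by (intro power_strict_mono) auto
    then show ?thesis by (simp add: \<phi>_def power2_norm_eq_inner max_def)
  qed
  have int: "integrable lborel (\<lambda>q. indicator U q *\<^sub>R \<phi> q *\<^sub>R h q)"
    using set_integrable_test_fun(1)[OF \<phi> loc_integrable_continuous[OF h]]
    by (simp add: set_integrable_def)
  define F where "F = (\<lambda>q. (indicator U q *\<^sub>R \<phi> q *\<^sub>R h q) \<bullet> h p)"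
  have F_int: "integrable lborel F" unfolding F_def using int by (rule integrable_inner_left)
  have F0: "(LINT q|lborel. F q) = 0"
    unfolding F_def using int 0[OF \<phi>]
    by (simp add: distr_act_def set_lebesgue_integral_def del: inner_scaleR_left)
  have F_pos: "F q > 0" if "q \<in> ball p r" for q
    
  proof -
    have "q \<in> W" using that r(2) ball_subset_cball[of p r] by blast
    then show ?thesis using \<phi>_pos[OF that] by (simp add: F_def W_def)
  qed
  have F_nn: "F q \<ge> 0" for q
    using F_pos[of q] \<phi>_0[of q] by (cases "q \<in> ball p r") (auto simp: F_def)
  \<comment> \<open>A nonnegative integrand with integral zero vanishes almost everywhere, so the
    ball on which it is positive would be a null set.\<close>
  have "AE q in lborel. F q = 0"
    using integral_nonneg_eq_0_iff_AE[OF F_int] F0 F_nn by simp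
  then have "AE q in lborel. q \<notin> ball p r"
    by eventually_elim (use F_pos in force)
  then have "emeasure lborel (ball p r) = 0"
    using AE_iff_measurable[of "ball p r" lborel "\<lambda>q. q \<notin> ball p r"]
    by (simp del: mem_ball)
  then show False
    using content_ball_pos[OF r(1), of p] by (simp add: measure_def)
qed

section \<open>Change of variables\<close>

lemma loc_integrable_cong:
  assumes "loc_integrable U f" "\<And>p. p \<in> U \<Longrightarrow> f p = g p"
  shows "loc_integrable U g"
  unfolding loc_integrable_def
proof (intro allI impI)
  fix K assume K: "compact K \<and> K \<subseteq> U"
  then have eq: "(\<lambda>p. indicator K p *\<^sub>R f p) = (\<lambda>p. indicator K p *\<^sub>R g p)"
    using assms(2) by (force simp: indicator_def)
  have "set_integrable lborel K f" using K assms(1) by (simp add: loc_integrable_def)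
  then show "set_integrable lborel K g"
    unfolding set_integrable_def by (rule back_subst[of "integrable lborel"]) (use eq in simp)
qed

text \<open>Substitution along \<Phi> from \<open>V\<close> to \<open>U\<close> with Jacobian
  \<open>w\<close> and inverse \<Psi>. The Jacobian formula is assumed for Borel sets of the whole
  space, so it can be checked slice by slice instead of through a determinant. Hence \<Phi> and
  \<open>w\<close> are measurable on the whole space, while continuity and the inverse refer to
  \<open>V\<close> and \<open>U\<close>.\<close>

locale lborel_substitution =
  fixes \<Phi> \<Psi> :: "'a::euclidean_space \<Rightarrow> 'a" and w :: "'a \<Rightarrow> real" and U V :: "'a set"
  assumes measurable_\<Phi>: "\<Phi> \<in> borel_measurable borel"
    and measurable_w: "w \<in> borel_measurable borel"
    and w_pos: "\<And>p. w p > 0"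
    and emeasure_eq: "\<And>A. A \<in> sets borel \<Longrightarrow>
      emeasure lborel A = (\<integral>\<^sup>+p. ennreal (w p) * indicator A (\<Phi> p) \<partial>lborel)"
    and open_U: "open U"
    and \<Phi>_mem_iff: "\<And>p. \<Phi> p \<in> U \<longleftrightarrow> p \<in> V"
    and continuous_\<Phi>: "continuous_on V \<Phi>"
    and continuous_w: "continuous_on V w"
    and inv: "\<And>p. p \<in> V \<Longrightarrow> \<Psi> (\<Phi> p) = p" "\<And>q. q \<in> U \<Longrightarrow> \<Phi> (\<Psi> q) = q"
begin

lemma lborel_eq: "lborel = distr (density lborel (\<lambda>p. ennreal (w p))) borel \<Phi>"
proof (rule measure_eqI)
  fix A :: "'a set"
  assume "A \<in> sets lborel"
  then have A: "A \<in> sets borel" by simp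
  then have "\<Phi> -` A \<in> sets borel"
    using measurable_sets[OF measurable_\<Phi> A] by simp
  then show "emeasure lborel A = emeasure (distr (density lborel (\<lambda>p. ennreal (w p))) borel \<Phi>) A"
    using A measurable_\<Phi> measurable_w
    by (simp add: emeasure_eq emeasure_distr emeasure_density indicator_vimage)
qed simp

lemma integrable_iff:
  fixes f :: "'a \<Rightarrow> 'b::euclidean_space"
  assumes "f \<in> borel_measurable borel"
  shows "integrable lborel f \<longleftrightarrow> integrable lborel (\<lambda>p. w p *\<^sub>R f (\<Phi> p))"
proof -
  have "integrable lborel f \<longleftrightarrow> integrable (distr (density lborel (\<lambda>p. ennreal (w p))) borel \<Phi>) f"
    by (rule arg_cong[OF lborel_eq])
  also have "\<dots> \<longleftrightarrow> integrable (density lborel (\<lambda>p. ennreal (w p))) (\<lambda>p. f (\<Phi> p))"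
    using measurable_\<Phi> assms by (intro integrable_distr_eq) auto
  also have "\<dots> \<longleftrightarrow> integrable lborel (\<lambda>p. w p *\<^sub>R f (\<Phi> p))"
    using measurable_w measurable_compose[OF measurable_\<Phi> assms] w_pos
    by (intro integrable_density) (auto intro: less_imp_le)
  finally show ?thesis .
qed

lemma integral_eq:
  fixes f :: "'a \<Rightarrow> 'b::euclidean_space"
  assumes "f \<in> borel_measurable borel"
  shows "(LINT p|lborel. f p) = (LINT p|lborel. w p *\<^sub>R f (\<Phi> p))"
proof -
  have "(LINT p|lborel. f p) = (LINT p|distr (density lborel (\<lambda>p. ennreal (w p))) borel \<Phi>. f p)"
    by (rule arg_cong[OF lborel_eq])
  also have "\<dots> = (LINT p|density lborel (\<lambda>p. ennreal (w p)). f (\<Phi> p))"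
    using measurable_\<Phi> assms by (intro integral_distr) auto
  also have "\<dots> = (LINT p|lborel. w p *\<^sub>R f (\<Phi> p))"
    using measurable_w measurable_compose[OF measurable_\<Phi> assms] w_pos
    by (intro integral_density) (auto intro: less_imp_le)
  finally show ?thesis .
qed

lemma set_lebesgue_integral_eq:
  fixes f :: "'a \<Rightarrow> 'b::euclidean_space"
  assumes "set_integrable lborel U f"
  shows "(LINT p:U|lborel. f p) = (LINT p:V|lborel. w p *\<^sub>R f (\<Phi> p))"
proof -
  have "(\<lambda>p. indicator U p *\<^sub>R f p) \<in> borel_measurable borel"
    using assms borel_measurable_integrable[of lborel "\<lambda>p. indicator U p *\<^sub>R f p"]
    by (simp add: set_integrable_def)
  from integral_eq[OF this] show ?thesis
    by (simp add: set_lebesgue_integral_def indicator_def \<Phi>_mem_iff mult.commute)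
qed

lemma loc_integrable_compose:
  fixes f :: "'a \<Rightarrow> 'b::euclidean_space"
  assumes f: "loc_integrable U f"
  shows "loc_integrable V (\<lambda>p. f (\<Phi> p))"
  unfolding loc_integrable_def
proof (intro allI impI, elim conjE)
  fix K :: "'a set"
  assume K: "compact K" "K \<subseteq> V"
  have "compact (\<Phi> ` K)"
    using K continuous_\<Phi> by (intro compact_continuous_image) (auto intro: continuous_on_subset)
  moreover have "\<Phi> ` K \<subseteq> U" using K \<Phi>_mem_iff by auto
  ultimately have int: "integrable lborel (\<lambda>p. indicator (\<Phi> ` K) p *\<^sub>R f p)"
    using f by (auto simp: loc_integrable_def set_integrable_def)
  then have "integrable lborel (\<lambda>p. w p *\<^sub>R indicator (\<Phi> ` K) (\<Phi> p) *\<^sub>R f (\<Phi> p))"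
    using integrable_iff[of "\<lambda>p. indicator (\<Phi> ` K) p *\<^sub>R f p"] borel_measurable_integrable[OF int]
    unfolding measurable_lborel2 by blast
  then have "integrable lborel (\<lambda>p. indicator K p *\<^sub>R w p *\<^sub>R indicator (\<Phi> ` K) (\<Phi> p) *\<^sub>R f (\<Phi> p))"
    by (rule integrable_mult_indicator[rotated]) (simp add: borel_compact K(1))
  also have "(\<lambda>p. indicator K p *\<^sub>R w p *\<^sub>R indicator (\<Phi> ` K) (\<Phi> p) *\<^sub>R f (\<Phi> p))
      = (\<lambda>p. indicator K p *\<^sub>R w p *\<^sub>R f (\<Phi> p))"
    by (auto simp: indicator_def)
  finally have "set_integrable lborel K (\<lambda>p. w p *\<^sub>R f (\<Phi> p))"
    by (simp add: set_integrable_def)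
  \<comment> \<open>Substitution gives integrability only with the factor \<open>w\<close>; it is
    divided out again, being continuous and positive on the compact \<open>K\<close>.\<close>
  moreover have "continuous_on K (\<lambda>p. inverse (w p))"
    using K continuous_w w_pos
    by (intro continuous_on_inverse) (auto intro: continuous_on_subset simp: less_imp_neq[symmetric])
  ultimately have "set_integrable lborel K (\<lambda>p. inverse (w p) *\<^sub>R w p *\<^sub>R f (\<Phi> p))"
    by (rule set_integrable_scaleR_continuous[OF K(1), rotated])
  moreover have "inverse (w p) *\<^sub>R w p *\<^sub>R f (\<Phi> p) = f (\<Phi> p)" for p
    using w_pos[of p] by simp
  ultimately show "set_integrable lborel K (\<lambda>p. f (\<Phi> p))" by simp
qed

text \<open>Carries test functions on the straightened domain \<open>V\<close> back to
  \<open>U\<close>. The free weight \<open>m\<close> serves two uses: 1 for the derivative in space,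
  1 / sqrt (l) for the derivative in time.\<close>

lemma test_fun_pullback:
  fixes m :: "'a \<Rightarrow> real"
  assumes \<psi>: "test_fun V \<psi>"
    and m: "\<And>q. q \<in> U \<Longrightarrow> (m has_derivative m' q) (at q)" "\<And>v. continuous_on U (\<lambda>q. m' q v)"
    and \<Psi>: "\<And>q. q \<in> U \<Longrightarrow> (\<Psi> has_derivative \<Psi>' q) (at q)" "\<And>v. continuous_on U (\<lambda>q. \<Psi>' q v)"
  defines "\<phi> \<equiv> \<lambda>q. if q \<in> U then m q * \<psi> (\<Psi> q) else 0"
  shows "test_fun U \<phi>"
    and "\<And>q v. q \<in> U \<Longrightarrow> frechet_derivative \<phi> (at q) v
      = m q * frechet_derivative \<psi> (at (\<Psi> q)) (\<Psi>' q v) + m' q v * \<psi> (\<Psi> q)"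
proof -
  obtain K where K: "compact K" "K \<subseteq> V" "\<And>p. p \<notin> K \<Longrightarrow> \<psi> p = 0"
    by (rule test_fun_compact_support[OF \<psi>]) (assumption | blast)+
  define \<phi>' where "\<phi>' = (\<lambda>q v. m q * frechet_derivative \<psi> (at (\<Psi> q)) (\<Psi>' q v) + m' q v * \<psi> (\<Psi> q))"
  have d: "(\<phi> has_derivative \<phi>' q) (at q)" if q: "q \<in> U" for q
  proof -
    have "((\<lambda>q. m q * \<psi> (\<Psi> q)) has_derivative \<phi>' q) (at q)"
      unfolding \<phi>'_def
      by (intro has_derivative_mult m(1) q has_derivative_compose[OF \<Psi>(1) test_fun_has_derivative[OF \<psi>]])
    then show ?thesis
      by (rule has_derivative_transform_within_open[OF _ open_U q]) (simp add: \<phi>_def)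
  qed
  have cm: "continuous_on U m" and c\<Psi>: "continuous_on U \<Psi>"
    using m(1) \<Psi>(1) by (auto intro!: has_derivative_continuous continuous_at_imp_continuous_on)
  \<comment> \<open>Continuity of the derivative of \<psi> is available for fixed directions only,
    while the direction \<open>\<Psi>' q v\<close> varies with \<open>q\<close>; expansion in the
    basis separates the two.\<close>
  have rep: "frechet_derivative \<psi> (at p) u = (\<Sum>b\<in>Basis. (u \<bullet> b) * frechet_derivative \<psi> (at p) b)" for p u
  proof -
    interpret linear "frechet_derivative \<psi> (at p)"
      using has_derivative_linear[OF test_fun_has_derivative[OF \<psi>]] .
    have "frechet_derivative \<psi> (at p) u = frechet_derivative \<psi> (at p) (\<Sum>b\<in>Basis. (u \<bullet> b) *\<^sub>R b)"
      by (simp add: euclidean_representation)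
    then show ?thesis by (simp add: sum scale)
  qed
  have c: "continuous_on U (\<lambda>q. \<phi>' q v)" for v
    unfolding \<phi>'_def
    by (subst rep)
      (intro continuous_intros cm m(2) \<Psi>(2) continuous_on_compose2[OF _ c\<Psi> subset_UNIV]
        test_fun_continuous_on[OF \<psi>])
  show "test_fun U \<phi>"
  proof (rule test_funI[OF open_U, of "\<Phi> ` K"])
    show "compact (\<Phi> ` K)"
      using K continuous_\<Phi> by (intro compact_continuous_image) (auto intro: continuous_on_subset)
    show "\<Phi> ` K \<subseteq> U" using K \<Phi>_mem_iff by auto
    show "\<phi> q = 0" if "q \<notin> \<Phi> ` K" for q
      using that inv(2)[of q] K(3)[of "\<Psi> q"] by (force simp: \<phi>_def)
  qed (use d c in blast)+
  show "frechet_derivative \<phi> (at q) v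
      = m q * frechet_derivative \<psi> (at (\<Psi> q)) (\<Psi>' q v) + m' q v * \<psi> (\<Psi> q)" if "q \<in> U" for q v
    using frechet_derivative_at[OF d[OF that]] unfolding \<phi>'_def by metis
qed

end

section \<open>The operator in space at a fixed time\<close>

text \<open>Tested with \<open>\<psi> ((s - l) / c)\<close>, the Jacobian \<open>c\<close> cancels
  the inner derivative 1 / c on the side of the derivative and survives as the factor of
  \<open>g\<close> on the other.\<close>

lemma has_weak_deriv_affine:
  fixes f g :: "real \<Rightarrow> 'b::euclidean_space"
  assumes c: "c > 0" and fg: "has_weak_deriv {l<..<l + c} 1 f g"
  shows "has_weak_deriv {0<..<1} 1 (\<lambda>z. f (l + c * z)) (\<lambda>z. c *\<^sub>R g (l + c * z))"
proof -
  interpret lborel_substitution "\<lambda>z. l + c * z" "\<lambda>s. (s - l) / c" "\<lambda>_. c" "{l<..<l + c}" "{0<..<1}"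
  proof
    fix A :: "real set"
    assume A: "A \<in> sets borel"
    have "emeasure lborel A = (\<integral>\<^sup>+s. indicator A s \<partial>lborel)" using A by simp
    also have "\<dots> = ennreal c * (\<integral>\<^sup>+z. indicator A (l + c * z) \<partial>lborel)"
      using A c by (subst nn_integral_real_affine[where c = c and t = l]) auto
    also have "\<dots> = (\<integral>\<^sup>+z. ennreal c * indicator A (l + c * z) \<partial>lborel)"
      using A by (intro nn_integral_cmult[symmetric] measurable_compose[OF _ borel_measurable_indicator]) auto
    finally show "emeasure lborel A = (\<integral>\<^sup>+z. ennreal c * indicator A (l + c * z) \<partial>lborel)" .
  next
    show "l + c * z \<in> {l<..<l + c} \<longleftrightarrow> z \<in> {0<..<1}" for z
      using c mult_less_cancel_left_pos[OF c, of z 1] by (simp add: zero_less_mult_iff)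
  qed (use c in \<open>auto intro!: continuous_intros\<close>)
  have loc: "loc_integrable {l<..<l + c} f" "loc_integrable {l<..<l + c} g"
    using fg by (auto simp: has_weak_deriv_def)
  have "distr_deriv {0<..<1} 1 (\<lambda>z. f (l + c * z)) \<psi> = distr_act {0<..<1} (\<lambda>z. c *\<^sub>R g (l + c * z)) \<psi>"
    if \<psi>: "test_fun {0<..<1} \<psi>" for \<psi>
  proof -
    \<comment> \<open>The factor 1 keeps \<phi> literally in the form
      \<open>m q * \<psi> (\<Psi> q)\<close> of the pullback.\<close>
    define \<phi> where "\<phi> = (\<lambda>s. if s \<in> {l<..<l + c} then 1 * \<psi> ((s - l) / c) else 0)"
    have "((\<lambda>s. (s - l) / c) has_derivative (\<lambda>h. h / c)) (at s)" for s
      using c by (auto intro!: derivative_eq_intros)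
    note \<phi> = test_fun_pullback[where m = "\<lambda>_. 1" and m' = "\<lambda>_ _. 0" and \<Psi>' = "\<lambda>_ h. h / c",
        OF \<psi> has_derivative_const continuous_on_const this continuous_on_const, folded \<phi>_def]
    have lin: "frechet_derivative \<psi> (at z) (1 / c) = (1 / c) * frechet_derivative \<psi> (at z) 1" for z
      using linear_cmul[OF has_derivative_linear[OF test_fun_has_derivative[OF \<psi>, of z]], of "1 / c" 1]
      by simp
    have "distr_deriv {l<..<l + c} 1 f \<phi> = distr_deriv {0<..<1} 1 (\<lambda>z. f (l + c * z)) \<psi>"
      unfolding distr_deriv_def set_lebesgue_integral_eq[OF set_integrable_test_fun(2)[OF \<phi>(1) loc(1)]]
      using c by (intro arg_cong[of _ _ uminus] set_lebesgue_integral_cong) (auto simp: \<phi>(2) lin)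
    moreover have "distr_act {l<..<l + c} g \<phi> = distr_act {0<..<1} (\<lambda>z. c *\<^sub>R g (l + c * z)) \<psi>"
      unfolding distr_act_def set_lebesgue_integral_eq[OF set_integrable_test_fun(1)[OF \<phi>(1) loc(2)]]
      using c by (intro set_lebesgue_integral_cong) (auto simp: \<phi>_def)
    moreover have "distr_deriv {l<..<l + c} 1 f \<phi> = distr_act {l<..<l + c} g \<phi>"
      using fg \<phi>(1) by (simp add: has_weak_deriv_def)
    ultimately show ?thesis by simp
  qed
  then show ?thesis
    using loc_integrable_compose[OF loc(1)]
      loc_integrable_scaleR_continuous[OF continuous_on_const loc_integrable_compose[OF loc(2)]]
    by (simp add: has_weak_deriv_def)
qed

section \<open>Straightening the moving domain\<close>

text \<open>On each time slice the map is affine with Jacobian \<open>l t\<close>, and Tonelli's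
  theorem assembles the slices. Off \<open>I\<close>, where nothing is known of \<open>a\<close> and
  \<open>l\<close>, it is replaced by the identity with Jacobian 1, so that it is a substitution of
  the whole plane.\<close>

lemma lborel_substitution_shear:
  fixes a l :: "real \<Rightarrow> real"
  assumes I: "open I" and c: "continuous_on I a" "continuous_on I l"
    and l: "\<And>t. t \<in> I \<Longrightarrow> l t > 0"
  shows "lborel_substitution
    (\<lambda>(t, z). (t, (if t \<in> I then a t else 0) + (if t \<in> I then l t else 1) * z))
    (\<lambda>(t, s). (t, (s - a t) / l t)) (\<lambda>(t, z). if t \<in> I then l t else 1)
    {(t, s). t \<in> I \<and> a t < s \<and> s < a t + l t} (I \<times> {0<..<1})"
proof -
  define \<alpha> where "\<alpha> = (\<lambda>t. if t \<in> I then a t else 0)"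
  define \<beta> where "\<beta> = (\<lambda>t. if t \<in> I then l t else 1)"
  have I_sets: "I \<in> sets borel" using I by simp
  have [measurable]: "\<alpha> \<in> borel_measurable borel" "\<beta> \<in> borel_measurable borel"
    unfolding \<alpha>_def \<beta>_def using c
    by (intro borel_measurable_continuous_on_if I_sets; simp)+
  have \<beta>_pos: "\<beta> t > 0" for t using l by (simp add: \<beta>_def)
  have c': "continuous_on I \<alpha>" "continuous_on I \<beta>"
    using c by (auto simp: \<alpha>_def \<beta>_def cong: continuous_on_cong)
  have mem: "s \<in> {a t<..<a t + l t} \<longleftrightarrow> (s - a t) / l t \<in> {0<..<1}" if "t \<in> I" for t s
    using l[OF that] by (auto simp: field_simps)
  have "lborel_substitution (\<lambda>(t, z). (t, \<alpha> t + \<beta> t * z))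
      (\<lambda>(t, s). (t, (s - a t) / l t)) (\<lambda>(t, z). \<beta> t)
      {(t, s). t \<in> I \<and> a t < s \<and> s < a t + l t} (I \<times> {0<..<1})"
  proof
    show m: "(\<lambda>(t, z). (t, \<alpha> t + \<beta> t * z)) \<in> borel_measurable (borel :: (real \<times> real) measure)"
      unfolding borel_prod[symmetric] by measurable
    show mw: "(\<lambda>(t, z). \<beta> t) \<in> borel_measurable (borel :: (real \<times> real) measure)"
      unfolding borel_prod[symmetric] by measurable
    show "(case p of (t, z) \<Rightarrow> \<beta> t) > 0" for p :: "real \<times> real"
      using \<beta>_pos by (cases p) simp
    fix A :: "(real \<times> real) set"
    assume A: "A \<in> sets borel"
    then have A': "A \<in> sets (lborel \<Otimes>\<^sub>M lborel)" unfolding lborel_prod by simp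
    note [measurable] = A'
    \<comment> \<open>Joint measurability, which Tonelli's theorem requires in addition to the
      identity on each slice.\<close>
    have "(\<lambda>p. ennreal (case p of (t, z) \<Rightarrow> \<beta> t) *
        indicator A (case p of (t, z) \<Rightarrow> (t, \<alpha> t + \<beta> t * z))) \<in> borel_measurable (lborel \<Otimes>\<^sub>M lborel)"
      unfolding lborel_prod measurable_lborel2
      by (intro borel_measurable_times_ennreal measurable_compose[OF mw measurable_ennreal]
          measurable_compose[OF m borel_measurable_indicator[OF A]])
    then have mF: "(\<lambda>(t, z). ennreal (\<beta> t) * indicator A (t, \<alpha> t + \<beta> t * z))
        \<in> borel_measurable (lborel \<Otimes>\<^sub>M lborel)"
      by (simp add: case_prod_unfold)
    have "emeasure lborel A = (\<integral>\<^sup>+p. indicator A p \<partial>(lborel \<Otimes>\<^sub>M lborel))"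
      using A by (simp add: lborel_prod)
    also have "\<dots> = (\<integral>\<^sup>+t. \<integral>\<^sup>+s. indicator A (t, s) \<partial>lborel \<partial>lborel)"
      by (intro lborel.nn_integral_fst[symmetric]) measurable
    also have "\<dots> = (\<integral>\<^sup>+t. \<integral>\<^sup>+z. ennreal (\<beta> t) * indicator A (t, \<alpha> t + \<beta> t * z) \<partial>lborel \<partial>lborel)"
    proof (rule nn_integral_cong)
      fix t :: real
      have "(\<integral>\<^sup>+s. indicator A (t, s) \<partial>lborel)
          = ennreal (\<beta> t) * (\<integral>\<^sup>+z. indicator A (t, \<alpha> t + \<beta> t * z) \<partial>lborel)"
        using \<beta>_pos[of t] by (subst nn_integral_real_affine[where c = "\<beta> t" and t = "\<alpha> t"]) auto
      also have "\<dots> = (\<integral>\<^sup>+z. ennreal (\<beta> t) * indicator A (t, \<alpha> t + \<beta> t * z) \<partial>lborel)"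
        by (intro nn_integral_cmult[symmetric]) measurable
      finally show "(\<integral>\<^sup>+s. indicator A (t, s) \<partial>lborel)
          = (\<integral>\<^sup>+z. ennreal (\<beta> t) * indicator A (t, \<alpha> t + \<beta> t * z) \<partial>lborel)" .
    qed
    also have "\<dots> = (\<integral>\<^sup>+(t, z). ennreal (\<beta> t) * indicator A (t, \<alpha> t + \<beta> t * z)
        \<partial>(lborel \<Otimes>\<^sub>M lborel))"
      using lborel.nn_integral_fst[OF mF] by simp
    finally show "emeasure lborel A = (\<integral>\<^sup>+p. ennreal (case p of (t, z) \<Rightarrow> \<beta> t) *
        indicator A (case p of (t, z) \<Rightarrow> (t, \<alpha> t + \<beta> t * z)) \<partial>lborel)"
      by (simp add: lborel_prod case_prod_unfold)
  next
    have c_fst: "continuous_on (I \<times> S) (\<lambda>p. a (fst p))" "continuous_on (I \<times> S) (\<lambda>p. l (fst p))"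
      for S :: "real set"
      by (rule continuous_on_compose2[OF c(1)] continuous_on_compose2[OF c(2)];
          auto intro!: continuous_intros)+
    \<comment> \<open>The moving domain is the preimage of the unit interval under the second
      component of the inverse map, which is continuous over \<open>I\<close>.\<close>
    have "open ((I \<times> UNIV) \<inter> (\<lambda>p. (snd p - a (fst p)) / l (fst p)) -` {0<..<1})"
      using I less_imp_neq[OF l]
      by (intro continuous_open_preimage continuous_intros c_fst open_Times) force+
    also have "(I \<times> UNIV) \<inter> (\<lambda>p. (snd p - a (fst p)) / l (fst p)) -` {0<..<1}
        = {(t, s). t \<in> I \<and> a t < s \<and> s < a t + l t}"
    proof (rule set_eqI)
      fix p :: "real \<times> real"
      show "p \<in> (I \<times> UNIV) \<inter> (\<lambda>p. (snd p - a (fst p)) / l (fst p)) -` {0<..<1}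
          \<longleftrightarrow> p \<in> {(t, s). t \<in> I \<and> a t < s \<and> s < a t + l t}"
        using mem[of "fst p" "snd p"] by (cases p) auto
    qed
    finally show "open {(t, s). t \<in> I \<and> a t < s \<and> s < a t + l t}" .
    show "(case p of (t, z) \<Rightarrow> (t, \<alpha> t + \<beta> t * z)) \<in> {(t, s). t \<in> I \<and> a t < s \<and> s < a t + l t}
        \<longleftrightarrow> p \<in> I \<times> {0<..<1}" for p
    proof -
      obtain t z where p: "p = (t, z)" by (cases p)
      show ?thesis
        using mem[of t "a t + l t * z"] l[of t] by (auto simp: p \<alpha>_def \<beta>_def)
    qed
    show "continuous_on (I \<times> {0<..<1}) (\<lambda>(t, z). (t, \<alpha> t + \<beta> t * z))"
      unfolding case_prod_unfold
      by (intro continuous_intros continuous_on_compose2[OF c'(1)] continuous_on_compose2[OF c'(2)]) auto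
    show "continuous_on (I \<times> {0<..<1}) (\<lambda>(t, z). \<beta> t)"
      unfolding case_prod_unfold
      by (intro continuous_intros continuous_on_compose2[OF c'(2)]) auto
    show "(\<lambda>(t, s). (t, (s - a t) / l t)) ((\<lambda>(t, z). (t, \<alpha> t + \<beta> t * z)) p) = p"
      if "p \<in> I \<times> {0<..<1}" for p
      using that l by (force simp: \<alpha>_def \<beta>_def)
    show "(\<lambda>(t, z). (t, \<alpha> t + \<beta> t * z)) ((\<lambda>(t, s). (t, (s - a t) / l t)) q) = q"
      if "q \<in> {(t, s). t \<in> I \<and> a t < s \<and> s < a t + l t}" for q
      using that l by (force simp: \<alpha>_def \<beta>_def)
  qed
  then show ?thesis by (simp only: \<alpha>_def \<beta>_def)
qed

text \<open>Only the kinematics of the domain enters: \<open>g\<close> is any weak time derivative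
  of \<open>f\<close>. The transport coefficient is minus the time derivative of the second
  component of the inverse map, read at the straightened point.\<close>

lemma weak_time_deriv_fixed_domain:
  fixes a l a' l' :: "real \<Rightarrow> real" and f g :: "real \<times> real \<Rightarrow> 'b::euclidean_space"
  assumes I: "open I" and l: "\<And>t. t \<in> I \<Longrightarrow> l t > 0"
    and da: "\<And>t. t \<in> I \<Longrightarrow> (a has_real_derivative a' t) (at t)" "continuous_on I a'"
    and dl: "\<And>t. t \<in> I \<Longrightarrow> (l has_real_derivative l' t) (at t)" "continuous_on I l'"
    and fg: "has_weak_deriv {(t, s). t \<in> I \<and> a t < s \<and> s < a t + l t} (1, 0) f g"
  defines "fh \<equiv> \<lambda>(t, z). sqrt (l t) *\<^sub>R f (t, a t + l t * z)"
    and "gh \<equiv> \<lambda>(t, z). sqrt (l t) *\<^sub>R g (t, a t + l t * z)"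
  shows "loc_integrable (I \<times> {0<..<1}) fh" "loc_integrable (I \<times> {0<..<1}) gh"
    and "\<And>\<psi>. test_fun (I \<times> {0<..<1}) \<psi> \<Longrightarrow>
      distr_deriv (I \<times> {0<..<1}) (1, 0) fh \<psi>
      = distr_act (I \<times> {0<..<1}) (\<lambda>(t, z). gh (t, z) - (1 / 2 * (l' t / l t)) *\<^sub>R fh (t, z)) \<psi>
      + distr_deriv (I \<times> {0<..<1}) (0, 1) (\<lambda>(t, z). ((a' t + l' t * z) / l t) *\<^sub>R fh (t, z)) \<psi>"
proof -
  define U where "U = {(t, s). t \<in> I \<and> a t < s \<and> s < a t + l t}"
  define V where "V = I \<times> {0<..<1::real}"
  define \<Phi> where "\<Phi> = (\<lambda>(t, z). (t, (if t \<in> I then a t else 0) + (if t \<in> I then l t else 1) * z))"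
  define \<Psi> where "\<Psi> = (\<lambda>(t, s). (t, (s - a t) / l t))"
  define w where "w = (\<lambda>(t, z::real). if t \<in> I then l t else 1)"
  have ca: "continuous_on I a" and cl: "continuous_on I l"
    using da(1) dl(1) by (auto intro!: DERIV_isCont continuous_at_imp_continuous_on)
  interpret lborel_substitution \<Phi> \<Psi> w U V
    unfolding \<Phi>_def \<Psi>_def w_def U_def V_def
    using I ca cl l by (rule lborel_substitution_shear)
  have loc: "loc_integrable U f" "loc_integrable U g"
    using fg by (auto simp: has_weak_deriv_def U_def)
  have fst_c: "continuous_on V (\<lambda>p. h (fst p))" if "continuous_on I h" for h :: "real \<Rightarrow> real"
    unfolding V_def by (rule continuous_on_compose2[OF that]) (auto intro!: continuous_intros)
  have fst_cU: "continuous_on U (\<lambda>p. h (fst p))" if "continuous_on I h" for h :: "real \<Rightarrow> real"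
    unfolding U_def by (rule continuous_on_compose2[OF that]) (auto intro!: continuous_intros)
  have V_l: "l (fst p) > 0" if "p \<in> V" for p
    using that l by (auto simp: V_def)
  have U_l: "l (fst q) > 0" if "q \<in> U" for q
    using that l by (auto simp: U_def)
  have fh_eq: "fh p = sqrt (l (fst p)) *\<^sub>R f (\<Phi> p)" and gh_eq: "gh p = sqrt (l (fst p)) *\<^sub>R g (\<Phi> p)"
    if "p \<in> V" for p
    using that by (auto simp: fh_def gh_def \<Phi>_def V_def)
  have fh: "loc_integrable V fh"
    by (rule loc_integrable_cong[OF loc_integrable_scaleR_continuous[OF
            fst_c[OF continuous_on_real_sqrt[OF cl]] loc_integrable_compose[OF loc(1)]]])
      (simp add: fh_eq)
  have gh: "loc_integrable V gh"
    by (rule loc_integrable_cong[OF loc_integrable_scaleR_continuous[OF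
            fst_c[OF continuous_on_real_sqrt[OF cl]] loc_integrable_compose[OF loc(2)]]])
      (simp add: gh_eq)
  show "loc_integrable (I \<times> {0<..<1}) fh" "loc_integrable (I \<times> {0<..<1}) gh"
    using fh gh by (simp_all add: V_def)
  \<comment> \<open>Jacobian times weight is l / sqrt (l) = sqrt (l), the factor in
    \<open>fh\<close> and \<open>gh\<close>.\<close>
  define m where "m = (\<lambda>q::real \<times> real. 1 / sqrt (l (fst q)))"
  \<comment> \<open>The derivative of l^(-1/2) is written as a multiple of \<open>m\<close>, so that
    after substitution it leaves the zero-order coefficient l' / (2 l) in front of \<psi>.\<close>
  define m' where "m' = (\<lambda>(q::real \<times> real) v::real \<times> real.
    - (l' (fst q) / l (fst q) * m q / 2 * fst v))"
  \<comment> \<open>Differentiating (s - a) / l in time at fixed \<open>s\<close> gives - (a' + l'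
    z) / l with z = (s - a) / l.\<close>
  define \<Psi>' where "\<Psi>' = (\<lambda>(q::real \<times> real) v::real \<times> real.
    (fst v, snd v / l (fst q) - fst v * (a' (fst q) + l' (fst q) * snd (\<Psi> q)) / l (fst q)))"
  have a_der: "((\<lambda>q. a (fst q)) has_derivative (\<lambda>v. a' (fst q) * fst v)) (at q)"
    and l_der: "((\<lambda>q. l (fst q)) has_derivative (\<lambda>v. l' (fst q) * fst v)) (at q)"
    if "q \<in> U" for q
    using that has_derivative_compose[OF has_derivative_fst[OF has_derivative_ident], of a _ q]
      has_derivative_compose[OF has_derivative_fst[OF has_derivative_ident], of l _ q]
      da(1)[of "fst q"] dl(1)[of "fst q"]
    by (auto simp: U_def has_field_derivative_def)
  have m_der: "(m has_derivative m' q) (at q)" if q: "q \<in> U" for q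
  proof -
    have "((\<lambda>y. 1 / sqrt y) has_real_derivative - (1 / sqrt (l (fst q)) / (2 * l (fst q)))) (at (l (fst q)))"
      using U_l[OF q] by (auto intro!: derivative_eq_intros simp: field_simps)
    from has_derivative_compose[OF l_der[OF q] this[unfolded has_field_derivative_def]]
    show ?thesis by (simp add: m_def m'_def field_simps)
  qed
  have \<Psi>_eq: "\<Psi> = (\<lambda>q. (fst q, (snd q - a (fst q)) / l (fst q)))"
    by (auto simp: \<Psi>_def)
  have \<Psi>_der: "(\<Psi> has_derivative \<Psi>' q) (at q)" if q: "q \<in> U" for q
  proof -
    have "((\<lambda>q. (snd q - a (fst q)) / l (fst q)) has_derivative
        (\<lambda>v. snd v / l (fst q) - fst v * (a' (fst q) + l' (fst q) * snd (\<Psi> q)) / l (fst q))) (at q)"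
      using U_l[OF q]
      by (auto intro!: derivative_eq_intros a_der[OF q] l_der[OF q] simp: \<Psi>_eq field_simps)
    then show ?thesis
      unfolding \<Psi>_eq \<Psi>'_def by (intro has_derivative_Pair has_derivative_fst has_derivative_ident) (simp add: \<Psi>_eq)
  qed
  have m_cont: "continuous_on U m"
    unfolding m_def using U_l
    by (intro continuous_intros fst_cU cl) (auto simp: less_imp_neq[symmetric])
  have m'_cont: "continuous_on U (\<lambda>q. m' q v)" for v
    unfolding m'_def using U_l
    by (intro continuous_intros m_cont fst_cU[OF cl] fst_cU[OF dl(2)]) (auto simp: less_imp_neq[symmetric])
  have \<Psi>'_cont: "continuous_on U (\<lambda>q. \<Psi>' q v)" for v
    unfolding \<Psi>'_def \<Psi>_eq using U_l
    by (auto intro!: continuous_intros fst_cU[OF cl] fst_cU[OF dl(2)] fst_cU[OF da(2)] fst_cU[OF ca]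
        simp: less_imp_neq[symmetric])
  fix \<psi> :: "real \<times> real \<Rightarrow> real"
  assume "test_fun (I \<times> {0<..<1}) \<psi>"
  then have \<psi>: "test_fun V \<psi>" by (simp add: V_def)
  define \<phi> where "\<phi> = (\<lambda>q. if q \<in> U then m q * \<psi> (\<Psi> q) else 0)"
  have \<phi>: "test_fun U \<phi>"
    "\<And>q v. q \<in> U \<Longrightarrow> frechet_derivative \<phi> (at q) v
      = m q * frechet_derivative \<psi> (at (\<Psi> q)) (\<Psi>' q v) + m' q v * \<psi> (\<Psi> q)"
    unfolding \<phi>_def
    by (rule test_fun_pullback[OF \<psi> m_der m'_cont \<Psi>_der \<Psi>'_cont]; assumption)+
  let ?d = "\<lambda>p v. frechet_derivative \<psi> (at p) v"
  let ?c = "\<lambda>(t, z). (a' t + l' t * z) / l t"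
  \<comment> \<open>The inverse map sends the time direction to (1, - c) with \<open>c\<close> the
    transport coefficient; linearity separates the time derivative from the transport part.\<close>
  have lin: "?d p (1, y) = ?d p (1, 0) + y * ?d p (0, 1)" for p and y :: real
  proof -
    interpret linear "?d p"
      using has_derivative_linear[OF test_fun_has_derivative[OF \<psi>]] .
    have "?d p (1, y) = ?d p ((1, 0) + y *\<^sub>R (0, 1))" by simp
    then show ?thesis by (simp only: add scale) simp
  qed
  have act: "distr_act U g \<phi> = (LINT p:V|lborel. \<psi> p *\<^sub>R gh p)"
    unfolding distr_act_def set_lebesgue_integral_eq[OF set_integrable_test_fun(1)[OF \<phi>(1) loc(2)]]
  proof (rule set_lebesgue_integral_cong)
    show "\<forall>p. p \<in> V \<longrightarrow> w p *\<^sub>R \<phi> (\<Phi> p) *\<^sub>R g (\<Phi> p) = \<psi> p *\<^sub>R gh p"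
    proof (intro allI impI)
      fix p assume p: "p \<in> V"
      then have wm: "w p * m (\<Phi> p) = sqrt (l (fst p))"
        using V_l[OF p] by (auto simp: w_def m_def \<Phi>_def V_def real_div_sqrt)
      have "w p *\<^sub>R \<phi> (\<Phi> p) *\<^sub>R g (\<Phi> p) = (w p * m (\<Phi> p)) *\<^sub>R \<psi> p *\<^sub>R g (\<Phi> p)"
        using p by (simp add: \<phi>_def \<Phi>_mem_iff inv mult.assoc)
      then show "w p *\<^sub>R \<phi> (\<Phi> p) *\<^sub>R g (\<Phi> p) = \<psi> p *\<^sub>R gh p"
        unfolding wm gh_eq[OF p] by (simp add: mult.commute)
    qed
  qed (use I in \<open>simp add: V_def borel_open open_Times\<close>)
  have deriv: "(LINT q:U|lborel. frechet_derivative \<phi> (at q) (1, 0) *\<^sub>R f q)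
      = (LINT p:V|lborel. ?d p (1, 0) *\<^sub>R fh p - \<psi> p *\<^sub>R (1 / 2 * (l' (fst p) / l (fst p))) *\<^sub>R fh p
          - ?d p (0, 1) *\<^sub>R ?c p *\<^sub>R fh p)"
    unfolding set_lebesgue_integral_eq[OF set_integrable_test_fun(2)[OF \<phi>(1) loc(1)]]
  proof (rule set_lebesgue_integral_cong)
    show "\<forall>p. p \<in> V \<longrightarrow> w p *\<^sub>R frechet_derivative \<phi> (at (\<Phi> p)) (1, 0) *\<^sub>R f (\<Phi> p)
      = ?d p (1, 0) *\<^sub>R fh p - \<psi> p *\<^sub>R (1 / 2 * (l' (fst p) / l (fst p))) *\<^sub>R fh p
          - ?d p (0, 1) *\<^sub>R ?c p *\<^sub>R fh p"
    proof (intro allI impI)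
      fix p assume p: "p \<in> V"
      obtain t z where tz: "p = (t, z)" by (cases p)
      have t: "t \<in> I" using p by (simp add: tz V_def)
      have \<Phi>p: "fst (\<Phi> p) = t" by (simp add: \<Phi>_def tz)
      have wm: "w p * m (\<Phi> p) = sqrt (l t)"
        using l[OF t] t by (simp add: w_def m_def \<Phi>p real_div_sqrt) (simp add: tz real_div_sqrt)
      have \<Psi>': "\<Psi>' (\<Phi> p) (1, 0) = (1, - ?c p)"
        using p by (simp add: \<Psi>'_def inv \<Phi>p) (simp add: tz)
      have "w p * frechet_derivative \<phi> (at (\<Phi> p)) (1, 0)
          = w p * m (\<Phi> p) * (?d p (1, - ?c p) - 1 / 2 * (l' t / l t) * \<psi> p)"
        using p by (simp add: \<phi>(2) \<Phi>_mem_iff inv \<Psi>' m'_def \<Phi>p field_simps)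
      also have "\<dots> = sqrt (l t) * (?d p (1, 0) - \<psi> p * (1 / 2 * (l' t / l t)) - ?d p (0, 1) * ?c p)"
        unfolding wm lin[of p "- ?c p"] by (simp add: algebra_simps)
      finally have eq: "w p * frechet_derivative \<phi> (at (\<Phi> p)) (1, 0)
        = (?d p (1, 0) - \<psi> p * (1 / 2 * (l' t / l t)) - ?d p (0, 1) * ?c p) * sqrt (l t)"
        by (simp only: mult.commute)
      have "w p *\<^sub>R frechet_derivative \<phi> (at (\<Phi> p)) (1, 0) *\<^sub>R f (\<Phi> p)
        = (?d p (1, 0) - \<psi> p * (1 / 2 * (l' t / l t)) - ?d p (0, 1) * ?c p) *\<^sub>R fh p"
        unfolding fh_eq[OF p] scaleR_scaleR eq by (simp add: tz)
      then show "w p *\<^sub>R frechet_derivative \<phi> (at (\<Phi> p)) (1, 0) *\<^sub>R f (\<Phi> p)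
        = ?d p (1, 0) *\<^sub>R fh p - \<psi> p *\<^sub>R (1 / 2 * (l' (fst p) / l (fst p))) *\<^sub>R fh p
          - ?d p (0, 1) *\<^sub>R ?c p *\<^sub>R fh p"
        by (simp add: scaleR_diff_left tz)
    qed
  qed (use I in \<open>simp add: V_def borel_open open_Times\<close>)
  \<comment> \<open>Each lower-order term is integrable against test functions by itself, which
    allows the integral over \<open>V\<close> to be split.\<close>
  have loc1: "loc_integrable V (\<lambda>p. (1 / 2 * (l' (fst p) / l (fst p))) *\<^sub>R fh p)"
    using V_l by (intro loc_integrable_scaleR_continuous fh continuous_intros fst_c[OF cl] fst_c[OF dl(2)])
      (auto simp: less_imp_neq[symmetric])
  have loc2: "loc_integrable V (\<lambda>p. ?c p *\<^sub>R fh p)"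
    unfolding case_prod_unfold using V_l
    by (intro loc_integrable_scaleR_continuous fh continuous_intros fst_c[OF cl] fst_c[OF dl(2)] fst_c[OF da(2)])
      (auto simp: less_imp_neq[symmetric])
  note int = set_integrable_test_fun(2)[OF \<psi> fh, of "(1, 0)"] set_integrable_test_fun(1)[OF \<psi> gh]
    set_integrable_test_fun(1)[OF \<psi> loc1] set_integrable_test_fun(2)[OF \<psi> loc2, of "(0, 1)"]
  have "- (LINT q:U|lborel. frechet_derivative \<phi> (at q) (1, 0) *\<^sub>R f q) = distr_act U g \<phi>"
    using fg \<phi>(1) by (auto simp: has_weak_deriv_def U_def distr_deriv_def)
  then have "- (LINT p:V|lborel. ?d p (1, 0) *\<^sub>R fh p)
      = (LINT p:V|lborel. \<psi> p *\<^sub>R gh p) - (LINT p:V|lborel. \<psi> p *\<^sub>R (1 / 2 * (l' (fst p) / l (fst p))) *\<^sub>R fh p)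
        - (LINT p:V|lborel. ?d p (0, 1) *\<^sub>R ?c p *\<^sub>R fh p)"
    unfolding deriv act using int by (simp add: set_integral_diff algebra_simps)
  also have "(LINT p:V|lborel. \<psi> p *\<^sub>R gh p) - (LINT p:V|lborel. \<psi> p *\<^sub>R (1 / 2 * (l' (fst p) / l (fst p))) *\<^sub>R fh p)
      = (LINT p:V|lborel. \<psi> p *\<^sub>R gh p - \<psi> p *\<^sub>R (1 / 2 * (l' (fst p) / l (fst p))) *\<^sub>R fh p)"
    using int(2,3) by (rule set_integral_diff(2)[symmetric])
  also have "\<dots> = distr_act V (\<lambda>(t, z). gh (t, z) - (1 / 2 * (l' t / l t)) *\<^sub>R fh (t, z)) \<psi>"
    unfolding distr_act_def by (simp only: scaleR_diff_right case_prod_unfold prod.collapse)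
  finally show "distr_deriv (I \<times> {0<..<1}) (1, 0) fh \<psi>
      = distr_act (I \<times> {0<..<1}) (\<lambda>(t, z). gh (t, z) - (1 / 2 * (l' t / l t)) *\<^sub>R fh (t, z)) \<psi>
      + distr_deriv (I \<times> {0<..<1}) (0, 1) (\<lambda>(t, z). ((a' t + l' t * z) / l t) *\<^sub>R fh (t, z)) \<psi>"
    by (simp add: distr_deriv_def V_def case_prod_unfold)
qed

section \<open>Classical solutions\<close>

text \<open>Serves at a fixed time, where factors depending on \<open>t\<close> alone are
  constants.\<close>

lemma has_weak_deriv_scaleR:
  assumes "has_weak_deriv U v f g"
  shows "has_weak_deriv U v (\<lambda>p. c *\<^sub>R f p) (\<lambda>p. c *\<^sub>R g p)"
proof -
  have "distr_deriv U v (\<lambda>p. c *\<^sub>R f p) \<phi> = c *\<^sub>R distr_deriv U v f \<phi>"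
    "distr_act U (\<lambda>p. c *\<^sub>R g p) \<phi> = c *\<^sub>R distr_act U g \<phi>" for \<phi>
    by (simp_all only: distr_deriv_def distr_act_def set_lebesgue_integral_def
        scaleR_left_commute[of _ c] integral_scaleR_right scaleR_minus_right)
  then show ?thesis
    using assms by (auto simp: has_weak_deriv_def intro: loc_integrable_scaleR_continuous continuous_on_const)
qed

lemma distr_act_add:
  assumes "loc_integrable U f" "loc_integrable U g" "test_fun U \<phi>"
  shows "distr_act U (\<lambda>p. f p + g p) \<phi> = distr_act U f \<phi> + distr_act U g \<phi>"
  unfolding distr_act_def scaleR_add_right
  by (rule set_integral_add(2)) (intro set_integrable_test_fun(1) assms)+

lemma distr_act_diff:
  assumes "loc_integrable U f" "loc_integrable U g" "test_fun U \<phi>"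
  shows "distr_act U (\<lambda>p. f p - g p) \<phi> = distr_act U f \<phi> - distr_act U g \<phi>"
  unfolding distr_act_def scaleR_diff_right
  by (rule set_integral_diff(2)) (intro set_integrable_test_fun(1) assms)+

text \<open>Makes the equation at a single time testable with a test function on space-time. Slices
  of the compact set \<open>K\<close> are compact as projections of
  \<open>K \<inter> ({t} \<times> UNIV)\<close>.\<close>

lemma test_fun_slice:
  fixes \<phi> :: "'a::euclidean_space \<times> 'b::euclidean_space \<Rightarrow> real"
  assumes U: "open U" and \<phi>: "test_fun U \<phi>"
  shows "test_fun {s. (t, s) \<in> U} (\<lambda>s. \<phi> (t, s))"
proof -
  obtain K where K: "compact K" "K \<subseteq> U" "\<And>p. p \<notin> K \<Longrightarrow> \<phi> p = 0"
    by (rule test_fun_compact_support[OF \<phi>]) (assumption | blast)+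
  show ?thesis
  proof (rule test_funI)
    have "open ((\<lambda>s. (t, s)) -` U)"
      using U by (rule open_vimage) (intro continuous_intros)
    then show "open {s. (t, s) \<in> U}" by (simp add: vimage_def)
    have "{s. (t, s) \<in> K} = snd ` (K \<inter> ({t} \<times> UNIV))" by force
    moreover have "compact (snd ` (K \<inter> ({t} \<times> UNIV)))"
      using K(1) by (intro compact_continuous_image continuous_intros compact_Int_closed closed_Times) auto
    ultimately show "compact {s. (t, s) \<in> K}" by simp
    show "{s. (t, s) \<in> K} \<subseteq> {s. (t, s) \<in> U}" using K(2) by auto
    show "\<phi> (t, s) = 0" if "s \<notin> {s. (t, s) \<in> K}" for s using K(3) that by simp
    show "((\<lambda>s. \<phi> (t, s)) has_derivative (\<lambda>h. frechet_derivative \<phi> (at (t, s)) (0, h))) (at s)" for s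
      by (rule has_derivative_compose[OF _ test_fun_has_derivative[OF \<phi>], of _ "\<lambda>h. (0, h)"])
        (auto intro!: derivative_eq_intros)
    show "continuous_on {s. (t, s) \<in> U} (\<lambda>s. frechet_derivative \<phi> (at (t, s)) (0, v))" for v
      by (rule continuous_on_compose2[OF test_fun_continuous_on(2)[OF \<phi>] _ subset_UNIV])
        (intro continuous_intros)
  qed
qed

text \<open>Fubini's theorem; it applies because the test function makes the integrand integrable
  over the whole product, although \<open>f\<close> is only locally integrable.\<close>

lemma distr_act_slices:
  fixes f :: "'a::euclidean_space \<times> 'b::euclidean_space \<Rightarrow> 'c::euclidean_space"
  assumes "loc_integrable U f" "test_fun U \<phi>"
  shows "distr_act U f \<phi>
    = (LINT t|lborel. distr_act {s. (t, s) \<in> U} (\<lambda>s. f (t, s)) (\<lambda>s. \<phi> (t, s)))"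
proof -
  have "integrable (lborel \<Otimes>\<^sub>M lborel) (\<lambda>p. indicator U p *\<^sub>R \<phi> p *\<^sub>R f p)"
    using set_integrable_test_fun(1)[OF assms(2,1)] by (simp add: set_integrable_def lborel_prod)
  from lborel_pair.integral_fst'[OF this] show ?thesis
    by (simp add: distr_act_def set_lebesgue_integral_def lborel_prod indicator_def)
qed

text \<open>The weak \<open>s\<close>-derivative is known on every time slice, so Fubini's theorem turns the system
  into an identity of distributions on \<open>U\<close>, both sides of which are continuous functions.\<close>

lemma weak_system_imp_classical:
  fixes J0 J1 Q :: "real^'n^'n" and x xt :: "real \<Rightarrow> real \<Rightarrow> real^'n"
  defines "X \<equiv> \<lambda>(t, s). x t s"
  assumes U: "open U" "U = {(t, s). t \<in> I \<and> a t < s \<and> s < b t}"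
    and d: "\<And>p. p \<in> U \<Longrightarrow> (X has_derivative X' p) (at p)"
    and c: "\<And>v. continuous_on U (\<lambda>p. X' p v)"
    and xt: "has_weak_deriv U (1, 0) X (\<lambda>(t, s). xt t s)"
    and J: "\<And>t. t \<in> I \<Longrightarrow> J_applied (a t) (b t) J0 J1 (\<lambda>s. Q *v x t s) (xt t)"
    and p: "p \<in> U"
  shows "X' p (1, 0) = J0 *v (Q *v X p) + J1 *v (Q *v X' p (0, 1))"
proof -
  have cX: "continuous_on U X"
    using d by (auto intro!: has_derivative_continuous continuous_at_imp_continuous_on)
  \<comment> \<open>The expected right-hand side is continuous, whereas \<open>xt\<close> is
    determined only up to null sets; the comparison therefore runs through distributions.\<close>
  define G where "G = (\<lambda>p. J0 *v (Q *v X p) + J1 *v (Q *v X' p (0, 1)))"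
  have cG: "continuous_on U G"
    unfolding G_def
    by (intro continuous_intros continuous_on_compose2[OF matrix_vector_mult_linear_continuous_on _ subset_UNIV]
        cX c)
  have loc: "loc_integrable U G" "loc_integrable U (\<lambda>p. X' p (1, 0))"
    by (rule loc_integrable_continuous, fact cG c)+
  have loc_xt: "loc_integrable U (\<lambda>(t, s). xt t s)"
    using xt by (simp add: has_weak_deriv_def)
  have "distr_act U (\<lambda>p. X' p (1, 0) - G p) \<phi> = 0" if \<phi>: "test_fun U \<phi>" for \<phi>
  proof -
    have slice: "distr_act {s. (t, s) \<in> U} (\<lambda>s. xt t s) (\<lambda>s. \<phi> (t, s))
        = distr_act {s. (t, s) \<in> U} (\<lambda>s. G (t, s)) (\<lambda>s. \<phi> (t, s))" for t
    proof (cases "t \<in> I")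
      case True
      define S where "S = {a t<..<b t}"
      have S: "{s. (t, s) \<in> U} = S" using True by (auto simp: U(2) S_def)
      have tU: "(t, s) \<in> U" if "s \<in> S" for s using that True by (simp add: U(2) S_def)
      have \<phi>t: "test_fun S (\<lambda>s. \<phi> (t, s))"
        using test_fun_slice[OF U(1) \<phi>, of t] by (simp only: S)
      have slice_c: "continuous_on S (\<lambda>s. h (t, s))" if "continuous_on U h" for h :: "real \<times> real \<Rightarrow> real^'n"
        by (rule continuous_on_compose2[OF that]) (auto intro!: continuous_intros tU)
      have x_der: "((\<lambda>s. x t s) has_derivative (\<lambda>h. X' (t, s) (0, h))) (at s)" if "s \<in> S" for s
      proof -
        have "((\<lambda>s. (t, s)) has_derivative (\<lambda>h. (0, h))) (at s)"
          by (auto intro!: derivative_eq_intros)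
        from has_derivative_compose[OF this, of X "X' (t, s)"] show ?thesis
          using d[OF tU[OF that]] by (simp add: X_def)
      qed
      \<comment> \<open>At fixed \<open>t\<close> the function \<open>J1 *v (Q *v x t s)\<close> has
        two weak derivatives, the classical one and the one supplied by the system, and these agree
        as distributions.\<close>
      have "has_weak_deriv S 1 (\<lambda>s. J1 *v (Q *v x t s)) (\<lambda>s. J1 *v (Q *v X' (t, s) (0, 1)))"
      proof (rule C1_has_weak_deriv[where f' = "\<lambda>s h. J1 *v (Q *v X' (t, s) (0, h))"])
        show "open S" by (simp add: S_def)
        show "((\<lambda>s. J1 *v (Q *v x t s)) has_derivative (\<lambda>h. J1 *v (Q *v X' (t, s) (0, h)))) (at s)"
          if "s \<in> S" for s
          by (intro bounded_linear.has_derivative[OF matrix_vector_mul_bounded_linear] x_der that)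
        show "continuous_on S (\<lambda>s. J1 *v (Q *v X' (t, s) (0, 1)))"
          by (intro continuous_on_compose2[OF matrix_vector_mult_linear_continuous_on _ subset_UNIV]
              slice_c[OF c])
      qed
      moreover have W: "has_weak_deriv S 1 (\<lambda>s. J1 *v (Q *v x t s)) (\<lambda>s. xt t s - J0 *v (Q *v x t s))"
        using J[OF True] by (simp add: J_applied_def S_def)
      ultimately have eq: "distr_act S (\<lambda>s. xt t s - J0 *v (Q *v x t s)) (\<lambda>s. \<phi> (t, s))
          = distr_act S (\<lambda>s. J1 *v (Q *v X' (t, s) (0, 1))) (\<lambda>s. \<phi> (t, s))"
        using \<phi>t by (simp add: has_weak_deriv_def)
      have l1: "loc_integrable S (\<lambda>s. xt t s - J0 *v (Q *v x t s))"
        using W by (simp add: has_weak_deriv_def)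
      have "continuous_on S (\<lambda>s. J0 *v (Q *v X (t, s)))"
        by (intro continuous_on_compose2[OF matrix_vector_mult_linear_continuous_on _ subset_UNIV]
            slice_c[OF cX])
      then have l2: "loc_integrable S (\<lambda>s. J0 *v (Q *v x t s))"
        by (simp add: X_def loc_integrable_continuous)
      have l3: "loc_integrable S (\<lambda>s. J1 *v (Q *v X' (t, s) (0, 1)))"
        by (intro loc_integrable_continuous slice_c[OF c]
            continuous_on_compose2[OF matrix_vector_mult_linear_continuous_on _ subset_UNIV])
      show ?thesis
        using distr_act_add[OF l1 l2 \<phi>t] distr_act_add[OF l3 l2 \<phi>t] eq
        by (simp add: S G_def X_def add.commute)
    next
      case False
      then have "{s. (t, s) \<in> U} = {}" by (auto simp: U(2))
      then show ?thesis by (simp add: distr_act_def set_lebesgue_integral_def)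
    qed
    \<comment> \<open>The classical time derivative and \<open>xt\<close> are both weak time
      derivatives of \<open>X\<close> on \<open>U\<close>.\<close>
    have "distr_act U (\<lambda>p. X' p (1, 0)) \<phi> = distr_act U (\<lambda>(t, s). xt t s) \<phi>"
      using xt C1_has_weak_deriv[OF U(1) d c, of "(1, 0)"] \<phi> by (simp add: has_weak_deriv_def)
    also have "\<dots> = distr_act U G \<phi>"
      unfolding distr_act_slices[OF loc_xt \<phi>] distr_act_slices[OF loc(1) \<phi>] using slice by simp
    finally show ?thesis
      using distr_act_diff[OF loc(2,1) \<phi>] by simp
  qed
  from distr_act_eq_0_imp_eq_0[OF U(1) continuous_on_diff[OF c cG] this p]
  have "X' p (1, 0) - G p = 0" .
  then show ?thesis by (simp add: G_def)
qed

text \<open>\<open>R\<close> is dense in \<open>S\<close>, and the set where \<open>h\<close> equals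
  \<open>c\<close> is closed relative to \<open>S\<close>. This carries the equation to the
  boundary, where testing gives no information.\<close>

lemma continuous_zero_on_closure:
  fixes h :: "'a::topological_space \<Rightarrow> 'b::t1_space"
  assumes h: "continuous_on S h" and "R \<subseteq> S" "S \<subseteq> closure R" and 0: "\<And>p. p \<in> R \<Longrightarrow> h p = c"
    and p: "p \<in> S"
  shows "h p = c"
proof -
  obtain C where C: "closed C" "{q \<in> S. h q = c} = S \<inter> C"
    using continuous_closedin_preimage_constant[OF h, of c] by (auto simp: closedin_closed)
  have "R \<subseteq> C" using 0 \<open>R \<subseteq> S\<close> C(2) by blast
  then have "closure R \<subseteq> C" using C(1) by (rule closure_minimal)
  then show ?thesis using C(2) p \<open>S \<subseteq> closure R\<close> by blast
qed

section \<open>The transformed port-Hamiltonian system\<close>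

theorem lemma2:
  fixes J0 J1 Q :: "real^'n^'n"
    and S1 :: "nat \<Rightarrow> nat \<Rightarrow> real" and M :: "nat \<Rightarrow> real^'n"
    and T :: "real set" and a b a' b' :: "real \<Rightarrow> real"
    and x xt xh eh :: "real \<Rightarrow> real \<Rightarrow> real^'n"
    and fb eb :: "real \<Rightarrow> nat \<Rightarrow> real"
  assumes J0: "transpose J0 = - J0"
    and J1: "transpose J1 = J1"
    and Q: "transpose Q = Q" "\<And>v. v \<noteq> 0 \<Longrightarrow> v \<bullet> (Q *v v) > 0"
    and T: "is_interval T" "interior T \<noteq> {}"
    and a: "\<And>t. t \<in> T \<Longrightarrow> (a has_real_derivative a' t) (at t within T)" "continuous_on T a'"
    and b: "\<And>t. t \<in> T \<Longrightarrow> (b has_real_derivative b' t) (at t within T)" "continuous_on T b'"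
    and ab: "\<And>t. t \<in> T \<Longrightarrow> a t < b t" "\<And>t. t \<in> T \<Longrightarrow> a' t * b' t \<ge> 0"
    and S1: "\<And>i j. i < rank J1 \<Longrightarrow> j < rank J1 \<Longrightarrow> S1 i j = S1 j i"
    and M: "dim (M ` {..<rank J1}) = rank J1"
    and dirac: "\<And>t. t \<in> T \<Longrightarrow>
          dirac_structure (a t) (b t) (rank J1) (stokes_dirac (a t) (b t) J0 J1 S1 M)"
    and x_L2: "\<And>t. t \<in> T \<Longrightarrow> L2_on {a t..b t} (x t)"
    and xt: "has_weak_deriv {(t, s). t \<in> interior T \<and> a t < s \<and> s < b t} (1, 0)
          (\<lambda>(t, s). x t s) (\<lambda>(t, s). xt t s)"
    and system: "\<And>t. t \<in> T \<Longrightarrow>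
          (xt t, fb t, \<lambda>s. Q *v x t s, eb t) \<in> stokes_dirac (a t) (b t) J0 J1 S1 M"
    and xh: "xh = (\<lambda>t z. sqrt (b t - a t) *\<^sub>R x t (a t + (b t - a t) * z))"
    and eh: "eh = (\<lambda>t z. Q *v xh t z)"
  shows
    \<comment> \<open>the equation in the sense of distributions\<close>
    "(\<exists>Jeh. (\<forall>t\<in>T. J_applied 0 1 J0 ((1 / (b t - a t)) *\<^sub>R J1) (eh t) (Jeh t)) \<and>
        loc_integrable (interior T \<times> {0<..<1}) (\<lambda>(t, z). xh t z) \<and>
        loc_integrable (interior T \<times> {0<..<1}) (\<lambda>(t, z). Jeh t z) \<and>
        (\<forall>\<phi>. test_fun (interior T \<times> {0<..<1}) \<phi> \<longrightarrow>
           distr_deriv (interior T \<times> {0<..<1}) (1, 0) (\<lambda>(t, z). xh t z) \<phi>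
           = distr_act (interior T \<times> {0<..<1})
               (\<lambda>(t, z). Jeh t z - (1 / 2 * ((b' t - a' t) / (b t - a t))) *\<^sub>R xh t z) \<phi>
             + distr_deriv (interior T \<times> {0<..<1}) (0, 1)
                 (\<lambda>(t, z). ((a' t + (b' t - a' t) * z) / (b t - a t)) *\<^sub>R xh t z) \<phi>)) \<and>
    \<comment> \<open>the equation pointwise, for classical solutions\<close>
     (C1_fun_on {(t, s). t \<in> T \<and> a t \<le> s \<and> s \<le> b t} (\<lambda>(t, s). x t s) \<longrightarrow>
        (\<forall>t\<in>T. \<forall>z\<in>{0..1}. \<exists>deh dcx.
           (eh t has_vector_derivative deh) (at z within {0..1}) \<and>
           ((\<lambda>z. ((a' t + (b' t - a' t) * z) / (b t - a t)) *\<^sub>R xh t z)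
              has_vector_derivative dcx) (at z within {0..1}) \<and>
           ((\<lambda>t. xh t z) has_vector_derivative
              (J0 *v eh t z + (1 / (b t - a t)) *\<^sub>R (J1 *v deh))
              - (1 / 2 * ((b' t - a' t) / (b t - a t))) *\<^sub>R xh t z + dcx) (at t within T)))"
proof (intro conjI impI)
  define I where "I = interior T"
  have I: "open I" "I \<subseteq> T" by (simp_all add: I_def interior_subset)
  define l where "l = (\<lambda>t. b t - a t)"
  define l' where "l' = (\<lambda>t. b' t - a' t)"
  have al: "a t + l t = b t" for t by (simp add: l_def)
  have l_pos: "l t > 0" if "t \<in> T" for t using ab(1)[OF that] by (simp add: l_def)
  have l: "(l has_real_derivative l' t) (at t within T)" if "t \<in> T" for t
    unfolding l_def l'_def using b(1)[OF that] a(1)[OF that] by (rule DERIV_diff)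
  have l': "continuous_on T l'"
    unfolding l'_def using a(2) b(2) by (intro continuous_intros)
  have ca: "continuous_on T a" using a(1) by (rule DERIV_continuous_on)
  have cl: "continuous_on T l" using l by (rule DERIV_continuous_on)
  have T_at: "at t within T = at t" if "t \<in> I" for t
    using that unfolding I_def by (rule at_within_interior)
  define U where "U = {(t, s). t \<in> I \<and> a t < s \<and> s < b t}"
  have J: "J_applied (a t) (b t) J0 J1 (\<lambda>s. Q *v x t s) (xt t)" if "t \<in> T" for t
    using system[OF that] by (simp add: stokes_dirac_def)
  {
    \<comment> \<open>Since \<open>xt t\<close> is the original operator applied to
      \<open>Q *v x t s\<close>, its image under the rescaling is the candidate for the transformed
      operator applied to \<open>eh t\<close>.\<close>
    define Jeh where "Jeh = (\<lambda>t z. sqrt (l t) *\<^sub>R xt t (a t + l t * z))"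
    have Japp: "J_applied 0 1 J0 ((1 / (b t - a t)) *\<^sub>R J1) (eh t) (Jeh t)" if t: "t \<in> T" for t
    proof -
      have lt: "l t > 0" using l_pos[OF t] .
      have "has_weak_deriv {a t<..<a t + l t} 1 (\<lambda>s. J1 *v (Q *v x t s)) (\<lambda>s. xt t s - J0 *v (Q *v x t s))"
        using J[OF t] by (simp add: J_applied_def al)
      \<comment> \<open>The affine rule multiplies the derivative by \<open>l t\<close>. The factor
        sqrt (l) / l corrects this to sqrt (l) and leaves 1 / l in front of \<open>J1\<close>, the
        coefficient in the transformed operator.\<close>
      from has_weak_deriv_scaleR[OF has_weak_deriv_affine[OF lt this], of "sqrt (l t) / l t"]
      have "has_weak_deriv {0<..<1} 1
          (\<lambda>z. (sqrt (l t) / l t) *\<^sub>R (J1 *v (Q *v x t (a t + l t * z))))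
          (\<lambda>z. sqrt (l t) *\<^sub>R (xt t (a t + l t * z) - J0 *v (Q *v x t (a t + l t * z))))"
        using lt by simp
      then show ?thesis
        by (simp add: J_applied_def eh xh Jeh_def matrix_vector_mult_scaleR scaleR_matrix_vector_assoc[symmetric]
            scaleR_diff_right l_def)
    qed
    have "has_weak_deriv {(t, s). t \<in> I \<and> a t < s \<and> s < a t + l t} (1, 0) (\<lambda>(t, s). x t s) (\<lambda>(t, s). xt t s)"
      using xt by (simp add: I_def al)
    note fixed = weak_time_deriv_fixed_domain[OF I(1) l_pos _ _ _ _ this, where a' = a' and l' = l']
    have der: "(a has_real_derivative a' t) (at t)" "(l has_real_derivative l' t) (at t)" if "t \<in> I" for t
      using a(1)[of t] l[of t] T_at[OF that] I(2) that by auto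
    have cont: "continuous_on I a'" "continuous_on I l'"
      using a(2) l' I(2) by (auto intro: continuous_on_subset)
    have xh_eq: "(\<lambda>(t, z). xh t z) = (\<lambda>(t, z). sqrt (l t) *\<^sub>R (case (t, a t + l t * z) of (t, s) \<Rightarrow> x t s))"
      and Jeh_eq: "(\<lambda>(t, z). Jeh t z) = (\<lambda>(t, z). sqrt (l t) *\<^sub>R (case (t, a t + l t * z) of (t, s) \<Rightarrow> xt t s))"
      by (auto simp: xh Jeh_def l_def)
    show "\<exists>Jeh. (\<forall>t\<in>T. J_applied 0 1 J0 ((1 / (b t - a t)) *\<^sub>R J1) (eh t) (Jeh t)) \<and>
        loc_integrable (interior T \<times> {0<..<1}) (\<lambda>(t, z). xh t z) \<and>
        loc_integrable (interior T \<times> {0<..<1}) (\<lambda>(t, z). Jeh t z) \<and>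
        (\<forall>\<phi>. test_fun (interior T \<times> {0<..<1}) \<phi> \<longrightarrow>
           distr_deriv (interior T \<times> {0<..<1}) (1, 0) (\<lambda>(t, z). xh t z) \<phi>
           = distr_act (interior T \<times> {0<..<1})
               (\<lambda>(t, z). Jeh t z - (1 / 2 * ((b' t - a' t) / (b t - a t))) *\<^sub>R xh t z) \<phi>
             + distr_deriv (interior T \<times> {0<..<1}) (0, 1)
                 (\<lambda>(t, z). ((a' t + (b' t - a' t) * z) / (b t - a t)) *\<^sub>R xh t z) \<phi>)"
    proof (intro exI[of _ Jeh] conjI ballI allI impI)
      show "J_applied 0 1 J0 ((1 / (b t - a t)) *\<^sub>R J1) (eh t) (Jeh t)" if "t \<in> T" for t
        using that by (rule Japp)
      show "loc_integrable (interior T \<times> {0<..<1}) (\<lambda>(t, z). xh t z)"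
        unfolding xh_eq I_def[symmetric] by (rule fixed(1)) (use I(2) der cont in blast)+
      show "loc_integrable (interior T \<times> {0<..<1}) (\<lambda>(t, z). Jeh t z)"
        unfolding Jeh_eq I_def[symmetric] by (rule fixed(2)) (use I(2) der cont in blast)+
      fix \<phi> :: "real \<times> real \<Rightarrow> real"
      assume \<phi>: "test_fun (interior T \<times> {0<..<1}) \<phi>"
      have "distr_deriv (I \<times> {0<..<1}) (1, 0) (\<lambda>(t, z). sqrt (l t) *\<^sub>R (case (t, a t + l t * z) of (t, s) \<Rightarrow> x t s)) \<phi>
        = distr_act (I \<times> {0<..<1}) (\<lambda>(t, z). (case (t, z) of (t, z) \<Rightarrow> sqrt (l t) *\<^sub>R (case (t, a t + l t * z) of (t, s) \<Rightarrow> xt t s))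
            - (1 / 2 * (l' t / l t)) *\<^sub>R (case (t, z) of (t, z) \<Rightarrow> sqrt (l t) *\<^sub>R (case (t, a t + l t * z) of (t, s) \<Rightarrow> x t s))) \<phi>
        + distr_deriv (I \<times> {0<..<1}) (0, 1)
            (\<lambda>(t, z). ((a' t + l' t * z) / l t) *\<^sub>R (case (t, z) of (t, z) \<Rightarrow> sqrt (l t) *\<^sub>R (case (t, a t + l t * z) of (t, s) \<Rightarrow> x t s))) \<phi>"
        by (rule fixed(3)) (use I(2) der cont \<phi> in \<open>auto simp: I_def\<close>)
      then show "distr_deriv (interior T \<times> {0<..<1}) (1, 0) (\<lambda>(t, z). xh t z) \<phi>
           = distr_act (interior T \<times> {0<..<1})
               (\<lambda>(t, z). Jeh t z - (1 / 2 * ((b' t - a' t) / (b t - a t))) *\<^sub>R xh t z) \<phi>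
             + distr_deriv (interior T \<times> {0<..<1}) (0, 1)
                 (\<lambda>(t, z). ((a' t + (b' t - a' t) * z) / (b t - a t)) *\<^sub>R xh t z) \<phi>"
        by (simp add: I_def xh Jeh_def l_def l'_def)
    qed
  }
  \<comment> \<open>Unlike \<open>U\<close>, the set \<open>D\<close> contains the moving boundary
    and the end points that belong to \<open>T\<close>; differentiability on it is relative to
    \<open>D\<close>.\<close>
  define D where "D = {(t, s). t \<in> T \<and> a t \<le> s \<and> s \<le> b t}"
  define X where "X = (\<lambda>(t, s). x t s)"
  assume "C1_fun_on {(t, s). t \<in> T \<and> a t \<le> s \<and> s \<le> b t} (\<lambda>(t, s). x t s)"
  then obtain X' where X': "\<And>p. p \<in> D \<Longrightarrow> (X has_derivative X' p) (at p within D)"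
    and cX': "\<And>v. continuous_on D (\<lambda>p. X' p v)"
    by (auto simp: C1_fun_on_def D_def X_def)
  have cX: "continuous_on D X"
    using X' by (rule has_derivative_continuous_on)
  have "U \<subseteq> D" using I(2) by (auto simp: U_def D_def)
  have U: "open U"
    using lborel_substitution.open_U[OF lborel_substitution_shear[of I a l]] I ca cl l_pos
    by (auto simp: U_def al intro: continuous_on_subset)
  have D_at: "at p within D = at p" if "p \<in> U" for p
    using interior_maximal[OF \<open>U \<subseteq> D\<close> U] that by (auto intro: at_within_interior)
  have on_U: "X' p (1, 0) = J0 *v (Q *v X p) + J1 *v (Q *v X' p (0, 1))" if "p \<in> U" for p
    unfolding X_def
  proof (rule weak_system_imp_classical[OF U U_def])
    show "((\<lambda>(t, s). x t s) has_derivative X' p) (at p)" if "p \<in> U" for p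
      using X'[of p] D_at[OF that] that \<open>U \<subseteq> D\<close> by (auto simp: X_def)
    show "continuous_on U (\<lambda>p. X' p v)" for v
      using cX' \<open>U \<subseteq> D\<close> by (rule continuous_on_subset)
    show "has_weak_deriv U (1, 0) (\<lambda>(t, s). x t s) (\<lambda>(t, s). xt t s)"
      using xt by (simp add: U_def I_def)
  qed (use J I(2) that in auto)
  define \<Gamma> where "\<Gamma> = (\<lambda>p. (fst p, a (fst p) + l (fst p) * snd p))"
  have \<Gamma>_D: "\<Gamma> ` (T \<times> {0..1}) \<subseteq> D"
  proof clarsimp
    fix t z :: real
    assume tz: "t \<in> T" "0 \<le> z" "z \<le> 1"
    then have "l t * z \<le> l t * 1" "0 \<le> l t * z"
      using l_pos[OF tz(1)] by (auto intro!: mult_left_mono)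
    then show "\<Gamma> (t, z) \<in> D" using tz al[of t] by (simp add: \<Gamma>_def D_def)
  qed
  have \<Gamma>_U: "\<Gamma> p \<in> U" if p: "p \<in> I \<times> {0<..<1}" for p
  proof -
    obtain t z where tz: "p = (t, z)" "t \<in> I" "0 < z" "z < 1" using p by auto
    then have "l t * z < l t * 1" "0 < l t * z"
      using l_pos[of t] I(2) by (auto intro!: mult_strict_left_mono)
    then show ?thesis using tz al[of t] by (simp add: \<Gamma>_def U_def)
  qed
  have c\<Gamma>: "continuous_on (T \<times> {0..1}) \<Gamma>"
    unfolding \<Gamma>_def by (intro continuous_intros continuous_on_compose2[OF ca] continuous_on_compose2[OF cl]) auto
  \<comment> \<open>The residual of the untransformed equation, known to vanish on \<open>U\<close>
    and continuous on all of \<open>D\<close>.\<close>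
  define h where "h = (\<lambda>p. X' p (1, 0) - (J0 *v (Q *v X p) + J1 *v (Q *v X' p (0, 1))))"
  have ch: "continuous_on D h"
    unfolding h_def
    by (intro continuous_intros cX cX'
        continuous_on_compose2[OF matrix_vector_mult_linear_continuous_on _ subset_UNIV])
  have pde: "X' (\<Gamma> p) (1, 0) = J0 *v (Q *v X (\<Gamma> p)) + J1 *v (Q *v X' (\<Gamma> p) (0, 1))"
    if p: "p \<in> T \<times> {0..1}" for p
  proof -
    have "h (\<Gamma> p) = 0"
    proof (rule continuous_zero_on_closure[of "T \<times> {0..1}" "\<lambda>p. h (\<Gamma> p)" "I \<times> {0<..<1}"])
      show "continuous_on (T \<times> {0..1}) (\<lambda>p. h (\<Gamma> p))"
        using ch c\<Gamma> \<Gamma>_D by (rule continuous_on_compose2)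
      show "I \<times> {0<..<1} \<subseteq> T \<times> {0..1::real}" using I(2) by auto
      \<comment> \<open>An interval with nonempty interior lies in the closure of its interior. On
        the straightened strip density then follows from the closure of a product, which is why the
        residual is composed with \<Gamma>.\<close>
      have "closure I = closure T"
        unfolding I_def using T by (intro convex_closure_interior is_interval_convex)
      then show "T \<times> {0..1} \<subseteq> closure (I \<times> {0<..<1::real})"
        using closure_subset[of T] by (auto simp: closure_Times)
      show "h (\<Gamma> p) = 0" if "p \<in> I \<times> {0<..<1}" for p
        using on_U[OF \<Gamma>_U[OF that]] by (simp add: h_def)
    qed (rule p)
    then show ?thesis by (simp add: h_def)
  qed
  \<comment> \<open>As \<open>X'\<close> is a derivative relative to \<open>D\<close>, the chain
    rule holds along curves that stay in \<open>D\<close>. This yields the one-sided derivatives at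
    z = 0, at z = 1 and at the ends of \<open>T\<close>.\<close>
  have chain: "((\<lambda>u. X (g u)) has_vector_derivative X' (g u) v) (at u within S)"
    if "(g has_vector_derivative v) (at u within S)" "g ` S \<subseteq> D" "u \<in> S"
    for g :: "real \<Rightarrow> real \<times> real" and u v S
  proof -
    have "g u \<in> D" using that by blast
    then have "linear (X' (g u))" using X' has_derivative_linear by blast
    then show ?thesis
      using has_derivative_in_compose2[OF X' that(2,3) that(1)[unfolded has_vector_derivative_def]]
      by (simp add: has_vector_derivative_def linear_cmul)
  qed
  show "\<forall>t\<in>T. \<forall>z\<in>{0..1}. \<exists>deh dcx.
           (eh t has_vector_derivative deh) (at z within {0..1}) \<and>
           ((\<lambda>z. ((a' t + (b' t - a' t) * z) / (b t - a t)) *\<^sub>R xh t z)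
              has_vector_derivative dcx) (at z within {0..1}) \<and>
           ((\<lambda>t. xh t z) has_vector_derivative
              (J0 *v eh t z + (1 / (b t - a t)) *\<^sub>R (J1 *v deh))
              - (1 / 2 * ((b' t - a' t) / (b t - a t))) *\<^sub>R xh t z + dcx) (at t within T)"
  proof (intro ballI)
    fix t z :: real
    assume t: "t \<in> T" and z: "z \<in> {0..1}"
    define r where "r = sqrt (l t)"
    have r: "r > 0" "l t = r * r" using l_pos[OF t] by (simp_all add: r_def)
    define p where "p = \<Gamma> (t, z)"
    \<comment> \<open>The velocity of the physical point a + l z at fixed \<open>z\<close>; divided
      by \<open>l t\<close> it is the transport coefficient.\<close>
    define y where "y = a' t + l' t * z"
    have p_D: "p \<in> D" unfolding p_def using t z \<Gamma>_D by blast
    have Xp: "X p = x t (a t + l t * z)" by (simp add: p_def \<Gamma>_def X_def)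
    have xh': "xh = (\<lambda>t z. sqrt (l t) *\<^sub>R X (\<Gamma> (t, z)))"
      by (simp add: xh X_def \<Gamma>_def l_def)
    have x_s: "((\<lambda>z. X (\<Gamma> (t, z))) has_vector_derivative l t *\<^sub>R X' p (0, 1)) (at z within {0..1})"
    proof -
      have "((\<lambda>z. \<Gamma> (t, z)) has_vector_derivative l t *\<^sub>R (0, 1)) (at z within {0..1})"
        unfolding \<Gamma>_def by (auto intro!: derivative_eq_intros)
      from chain[OF this _ z] show ?thesis
        using \<Gamma>_D t linear_cmul[OF has_derivative_linear[OF X'[OF p_D]], of "l t" "(0, 1)"]
        by (auto simp: p_def)
    qed
    have xh_s: "(xh t has_vector_derivative r *\<^sub>R l t *\<^sub>R X' p (0, 1)) (at z within {0..1})"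
      unfolding xh' r_def by (rule bounded_linear.has_vector_derivative[OF bounded_linear_scaleR_right x_s])
    have "((\<lambda>z. (a' t + (b' t - a' t) * z) / (b t - a t)) has_real_derivative l' t / l t) (at z within {0..1})"
      using l_pos[OF t] by (auto intro!: derivative_eq_intros simp: l_def l'_def)
    from has_vector_derivative_scaleR[OF this xh_s]
    have cx: "((\<lambda>z. ((a' t + (b' t - a' t) * z) / (b t - a t)) *\<^sub>R xh t z) has_vector_derivative
        (y / l t) *\<^sub>R r *\<^sub>R l t *\<^sub>R X' p (0, 1) + (l' t / l t) *\<^sub>R xh t z) (at z within {0..1})"
      by (simp add: l_def l'_def y_def)
    have eh_s: "(eh t has_vector_derivative Q *v (r *\<^sub>R l t *\<^sub>R X' p (0, 1))) (at z within {0..1})"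
      unfolding eh by (rule bounded_linear.has_vector_derivative[OF matrix_vector_mul_bounded_linear xh_s])
    have x_t: "((\<lambda>t. X (\<Gamma> (t, z))) has_vector_derivative X' p (1, y)) (at t within T)"
    proof -
      have "((\<lambda>t. \<Gamma> (t, z)) has_vector_derivative (1, y)) (at t within T)"
        unfolding \<Gamma>_def y_def using a(1)[OF t] l[OF t]
        by (auto intro!: derivative_eq_intros simp: has_real_derivative_iff_has_vector_derivative[symmetric])
      moreover have "(\<lambda>t. \<Gamma> (t, z)) ` T \<subseteq> D"
        using \<Gamma>_D z by (auto simp: image_subset_iff)
      ultimately show ?thesis
        unfolding p_def using t by (rule chain)
    qed
    have "((\<lambda>t. sqrt (l t)) has_real_derivative l' t / (2 * r)) (at t within T)"
      using l[OF t] l_pos[OF t] by (auto intro!: derivative_eq_intros simp: r_def field_simps)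
    from has_vector_derivative_scaleR[OF this x_t]
    have xh_t: "((\<lambda>t. xh t z) has_vector_derivative r *\<^sub>R X' p (1, y) + (l' t / (2 * r)) *\<^sub>R X p) (at t within T)"
      by (simp add: xh' r_def p_def)
    \<comment> \<open>Material derivative along the moving point: the time derivative plus
      convection with velocity \<open>y\<close>.\<close>
    have "X' p (1, y) = X' p ((1, 0) + y *\<^sub>R (0, 1))" by simp
    also have "\<dots> = X' p (1, 0) + y *\<^sub>R X' p (0, 1)"
      using has_derivative_linear[OF X'[OF p_D]] by (simp only: linear_add linear_cmul)
    also have "X' p (1, 0) = J0 *v (Q *v X p) + J1 *v (Q *v X' p (0, 1))"
      unfolding p_def using t z by (intro pde) auto
    finally have X'p: "X' p (1, y) = J0 *v (Q *v X p) + J1 *v (Q *v X' p (0, 1)) + y *\<^sub>R X' p (0, 1)" .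
    have xh_p: "xh t z = r *\<^sub>R X p" by (simp add: xh' r_def p_def)
    have "r *\<^sub>R X' p (1, y) + (l' t / (2 * r)) *\<^sub>R X p
      = (J0 *v eh t z + (1 / (b t - a t)) *\<^sub>R (J1 *v (Q *v (r *\<^sub>R l t *\<^sub>R X' p (0, 1)))))
        - (1 / 2 * ((b' t - a' t) / (b t - a t))) *\<^sub>R xh t z
        + ((y / l t) *\<^sub>R r *\<^sub>R l t *\<^sub>R X' p (0, 1) + (l' t / l t) *\<^sub>R xh t z)"
    proof -
      have l_eq: "b t - a t = l t" "b' t - a' t = l' t" by (simp_all add: l_def l'_def)
      have 1: "(1 / l t) * (r * l t) = r" "(y / l t) * (r * l t) = r * y" using r by simp_all
      \<comment> \<open>Origin of the coefficient - 1/2: differentiating sqrt (l) contributes l' /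
        (2 l) times \<open>xh\<close>, the transport term in divergence form already contains l' / l
        times \<open>xh\<close>, and the excess is subtracted.\<close>
      have 2: "l' t / (2 * r) = (l' t / l t) * r - (1 / 2 * (l' t / l t)) * r"
        using r by (simp add: field_simps)
      show ?thesis
        unfolding l_eq X'p eh xh_p 2
        by (simp only: matrix_vector_mult_scaleR scaleR_scaleR 1 scaleR_add_right scaleR_diff_left)
           (simp add: algebra_simps)
    qed
    with xh_t have "((\<lambda>t. xh t z) has_vector_derivative
        (J0 *v eh t z + (1 / (b t - a t)) *\<^sub>R (J1 *v (Q *v (r *\<^sub>R l t *\<^sub>R X' p (0, 1)))))
        - (1 / 2 * ((b' t - a' t) / (b t - a t))) *\<^sub>R xh t z
        + ((y / l t) *\<^sub>R r *\<^sub>R l t *\<^sub>R X' p (0, 1) + (l' t / l t) *\<^sub>R xh t z)) (at t within T)"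
      by simp
    with eh_s cx show "\<exists>deh dcx.
           (eh t has_vector_derivative deh) (at z within {0..1}) \<and>
           ((\<lambda>z. ((a' t + (b' t - a' t) * z) / (b t - a t)) *\<^sub>R xh t z)
              has_vector_derivative dcx) (at z within {0..1}) \<and>
           ((\<lambda>t. xh t z) has_vector_derivative
              (J0 *v eh t z + (1 / (b t - a t)) *\<^sub>R (J1 *v deh))
              - (1 / 2 * ((b' t - a' t) / (b t - a t))) *\<^sub>R xh t z + dcx) (at t within T)"
      by blast
  qed
qed

end
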